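(* Let $p>3$ be a prime. Then $$\sum_{k=0}^{(p-1)/2}\frac{\binom{2k}k^3}{(-8)^k(k+2)}\equiv\begin{cases}\frac{64}{27}x^2-\frac{35}{27}p\pmod{p^2}&\text{if } p\equiv 1\pmod 4 \text{ and } p=x^2+4y^2 \text{ with } x,y\in\mathbb Z,\\ \frac p9\pmod{p^2}&\text{if } p\equiv 3\pmod 4.\end{cases}$$
   Context: For a prime $p$, congruences modulo $p^r$ between rational numbers whose denominators are prime to $p$ mean that the difference is $p^r$ times a rational number with denominator prime to $p$. *)

theory Defs
  imports Complex_Main "HOL-Computational_Algebra.Primes"
begin

definition rat_cong_pow :: "nat \<Rightarrow> nat \<Rightarrow> rat \<Rightarrow> rat \<Rightarrow> bool" where
  "rat_cong_pow p r a b \<longleftrightarrow>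
     (\<exists>c::rat. a - b = of_nat (p ^ r) * c \<and> coprime (snd (quotient_of c)) (int p))"

end

theory Submission
  imports Defs "HOL-Number_Theory.Number_Theory"
begin

text \<open>
  Let \<open>n = (p - 1) / 2\<close> and \<open>a\<^sub>k = (2k choose k)\<^sup>3 / (-8)\<^sup>k\<close>.  Since \<open>(k + 1)\<^sup>3 a\<^sub>k\<^sub>+\<^sub>1 = - (2k + 1)\<^sup>3 a\<^sub>k\<close>, a telescoping sum
  gives \<open>27 \<Sum> a\<^sub>k / (k + 2) \<equiv> 16 \<Sum> a\<^sub>k - 3 \<Sum> (3k + 1) a\<^sub>k\<close> modulo \<open>p\<^sup>2\<close>.

  Replacing \<open>(1/2)\<^sub>k\<^sup>2 / k!\<^sup>2\<close> in \<open>a\<^sub>k\<close> by \<open>(1/2 - p/2)\<^sub>k (1/2 + p/2)\<^sub>k / ((1 - p)\<^sub>k (1 + p)\<^sub>k)\<close> does not change the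
  terms modulo \<open>p\<^sup>2\<close>, and both sums then have closed forms for every odd \<open>p = 2n + 1\<close>, provable by
  creative telescoping in \<open>n\<close>: the one with weight \<open>3k + 1\<close> is \<open>(-1)\<^sup>n p\<close>, the other one vanishes for
  odd \<open>n\<close> and is \<open>p 16\<^sup>m (2m choose m) / ((6m + 1) (6m choose 3m))\<close> for \<open>n = 2m\<close>.

  For \<open>p = 4m + 1 = x\<^sup>2 + 4 y\<^sup>2\<close>, Jacobsthal's theorem says that the character sum
  \<open>J = \<Sum> (t / p) ((t\<^sup>2 + 1) / p)\<close> satisfies \<open>J\<^sup>2 = 4 x\<^sup>2\<close>.  Lifting the Legendre symbols to the modulus \<open>p\<^sup>2\<close> by
  powers of \<open>t\<^sup>p\<close> and by a Newton step expresses \<open>J\<close> through the binomial coefficients \<open>2m choose m\<close>,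
  \<open>6m choose m\<close> and \<open>6m choose 3m\<close>.  All of these are values of \<open>f z = (z + m + 1) \<cdots> (z + 2m) / m!\<close> at small multiples
  of \<open>p\<close> up to simple factors, and \<open>f\<close> is affine modulo \<open>p\<^sup>2\<close> there; comparing the expansions yields that
  the closed form is congruent to \<open>J\<^sup>2 - 2 p\<close>.
\<close>

section \<open>Two terminating hypergeometric sums\<close>

text \<open>Equal to (-8)^k (1/2)_k / k!, the factor of the summand that does not depend on
  \<open>n\<close>.\<close>

definition wz_coeff :: "nat \<Rightarrow> rat" where
  "wz_coeff k = (-2) ^ k * of_nat ((2 * k) choose k)"

text \<open>With \<open>q = 2n + 1\<close>, this is
  \<open>q\<^sup>-\<^sup>1 (-8)\<^sup>k (1/2)\<^sub>k (1/2 - q/2)\<^sub>k (1/2 + q/2)\<^sub>k / (k! (1 - q)\<^sub>k (1 + q)\<^sub>k)\<close>. It is meant for \<open>k \<le> n\<close> only,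
  because of the truncated subtractions.\<close>

definition wz_term :: "nat \<Rightarrow> nat \<Rightarrow> rat" where
  "wz_term n k = wz_coeff k * fact (n + k) * fact (2 * n - k) / (fact (n - k) * fact (2 * n + 1 + k))"

lemma central_binomial_Suc:
  "of_nat ((2 * (k + 1)) choose (k + 1)) = (2 * (2 * of_nat k + 1) / (of_nat k + 1) * of_nat ((2 * k) choose k) :: rat)"
proof -
  have "of_nat ((2 * (k + 1)) choose (k + 1)) = (fact (2 * k + 2) / (fact (k + 1) * fact (k + 1)) :: rat)"
    by (subst binomial_fact) simp_all
  also have "\<dots> = (2 * of_nat k + 2) * (2 * of_nat k + 1) / ((of_nat k + 1) * (of_nat k + 1))
                   * (fact (2 * k) / (fact k * fact k))"
    by (simp add: mult_ac add_ac)
  also have "fact (2 * k) / (fact k * fact k) = (of_nat ((2 * k) choose k) :: rat)"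
    by (subst binomial_fact) simp_all
  also have "(2 * of_nat k + 2) * (2 * of_nat k + 1) / ((of_nat k + 1) * (of_nat k + 1))
     = (2 * (2 * of_nat k + 1) / (of_nat k + 1) :: rat)"
  proof -
    have "(of_nat k + 1 :: rat) \<noteq> 0" by (metis of_nat_Suc of_nat_neq_0 add.commute)
    moreover have "(2 * of_nat k + 2) * (2 * of_nat k + 1) = (of_nat k + 1) * (2 * (2 * of_nat k + 1) :: rat)"
      by (simp add: algebra_simps)
    ultimately show ?thesis by simp
  qed
  finally show ?thesis .
qed

lemma wz_coeff_0 [simp]: "wz_coeff 0 = 1"
  by (simp add: wz_coeff_def)

lemma wz_coeff_Suc: "wz_coeff (Suc k) = -4 * (2 * of_nat k + 1) / (of_nat k + 1) * wz_coeff k"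
proof -
  have "wz_coeff (Suc k) = (-2) ^ Suc k * of_nat ((2 * (k + 1)) choose (k + 1))"
    by (simp only: wz_coeff_def Suc_eq_plus1)
  also have "\<dots> = -4 * (2 * of_nat k + 1) / (of_nat k + 1) * wz_coeff k"
    unfolding central_binomial_Suc wz_coeff_def by (simp add: divide_simps) (simp add: algebra_simps)
  finally show ?thesis .
qed

text \<open>Used to pass from the factorials in the denominator of \<open>wz_term n k\<close> to the
  larger ones in a common factor \<open>h\<close>, at the price of the polynomials \<open>x\<close>
  and \<open>y\<close>.\<close>

lemma expand_fraction:
  fixes a :: rat
  assumes "x \<noteq> 0" "y \<noteq> 0"
  shows "a / (u * v) = x * y * (a / ((x * u) * (y * v)))"
  using assms by simp

section \<open>Creative telescoping for the sum with weight 3k + 1\<close>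

text \<open>The two certificates are the output of Zeilberger's algorithm, for the shifts \<open>n \<mapsto> n + 1\<close>
  and \<open>n \<mapsto> n + 2\<close> respectively.\<close>

definition wz_cert1 :: "nat \<Rightarrow> nat \<Rightarrow> rat" where
  "wz_cert1 n k = 2 * (of_nat n + 1) * of_nat k * wz_coeff k
     * fact (n + k) * fact (2 * n + 1 - k) / (fact (n + 1 - k) * fact (2 * n + 2 + k))"

text \<open>With \<open>n = k + d\<close> no truncated subtraction is left, and all four quantities
  are polynomials in \<open>K\<close> and \<open>D\<close> times one quotient \<open>h\<close> of
  factorials; what remains is a polynomial identity.\<close>

lemma wz_cert1_step:
  assumes "k \<le> n"
  shows "(3 * of_nat k + 1) * (wz_term (n + 1) k + wz_term n k) = wz_cert1 n k - wz_cert1 n (k + 1)"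
proof -
  obtain d where n: "n = k + d" using assms le_Suc_ex by blast
  define K D :: rat where "K = of_nat k" and "D = of_nat d"
  define b where "b = wz_coeff k"
  define h :: rat where "h = b * fact (2 * k + d) * fact (k + 2 * d)
     / (fact (d + 1) * fact (3 * k + 2 * d + 3))"
  have N: "of_nat n = K + D" by (simp add: n K_def D_def)
  have pos: "K \<ge> 0" "D \<ge> 0" by (simp_all add: K_def D_def)
  then have nz: "D + 1 \<noteq> 0" "K + 1 \<noteq> 0" "3*K+2*D+2 \<noteq> 0" "3*K+2*D+3 \<noteq> 0" by linarith+
  have b': "wz_coeff (k + 1) = -4 * (2*K+1) / (K+1) * b"
    using wz_coeff_Suc[of k] by (simp add: b_def K_def)
  have f1: "fact (d + 1) = (D + 1) * (fact d :: rat)" by (simp add: D_def algebra_simps)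
  have f2: "fact (2 * k + d + 1) = (2*K+D+1) * (fact (2 * k + d) :: rat)" by (simp add: D_def K_def algebra_simps)
  have f2': "fact (k + 2 * d + 1) = (K+2*D+1) * (fact (k + 2 * d) :: rat)" by (simp add: D_def K_def algebra_simps)
  have f2'': "fact (k + 2 * d + 2) = (K+2*D+2) * (K+2*D+1) * (fact (k + 2 * d) :: rat)" by (simp add: D_def K_def algebra_simps)
  have f3': "fact (3 * k + 2 * d + 3) = (3*K+2*D+3) * (fact (3 * k + 2 * d + 2) :: rat)"
    by (simp add: D_def K_def add_ac numeral_eq_Suc)
  have f3: "fact (3 * k + 2 * d + 3) = (3*K+2*D+3) * (3*K+2*D+2) * (fact (3 * k + 2 * d + 1) :: rat)"
    by (simp add: D_def K_def add_ac mult_ac numeral_eq_Suc)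
  have s0: "wz_term n k = (D+1) * ((3*K+2*D+3) * (3*K+2*D+2)) * h"
  proof -
    have e: "n + k = 2 * k + d" "2 * n - k = k + 2 * d" "n - k = d" "2 * n + 1 + k = 3 * k + 2 * d + 1"
      using n by auto
    have "D+1 \<noteq> 0" "(3*K+2*D+3) * (3*K+2*D+2) \<noteq> 0"
      using nz by simp_all
    from expand_fraction[OF this] show ?thesis
      unfolding wz_term_def h_def f1 f3 e b_def by blast
  qed
  have s1: "wz_term (n+1) k = (2*K+D+1) * ((K+2*D+2) * (K+2*D+1)) * h"
  proof -
    have e: "n + 1 + k = 2 * k + d + 1" "2 * (n + 1) - k = k + 2 * d + 2" "n + 1 - k = d + 1"
       "2 * (n + 1) + 1 + k = 3 * k + 2 * d + 3"
      using n by auto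
    show ?thesis unfolding wz_term_def h_def f2 f2'' e b_def by (simp add: mult_ac)
  qed
  have g0: "wz_cert1 n k = 2*(K+D+1) * K * (K+2*D+1) * (3*K+2*D+3) * h"
  proof -
    have e: "n + k = 2 * k + d" "2 * n + 1 - k = k + 2 * d + 1" "n + 1 - k = d + 1" "2 * n + 2 + k = 3 * k + 2 * d + 2"
      using n by auto
    show ?thesis using nz(4)
      unfolding wz_cert1_def N K_def[symmetric] e b_def[symmetric] h_def f2' f3'
      by (simp add: mult_ac del: fact_Suc)
  qed
  have g1: "wz_cert1 n (k+1) = 2*(K+D+1) * (-4*(2*K+1)) * (2*K+D+1) * (D+1) * h"
  proof -
    have K': "of_nat (k + 1) = K + 1" by (simp add: K_def)
    have e: "n + (k + 1) = 2 * k + d + 1" "2 * n + 1 - (k + 1) = k + 2 * d" "n + 1 - (k + 1) = d" "2 * n + 2 + (k + 1) = 3 * k + 2 * d + 3"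
      using n by auto
    show ?thesis using nz(1,2)
      unfolding wz_cert1_def N K' e b' h_def f2 f1
      by (simp add: mult_ac del: fact_Suc)
  qed
  show ?thesis unfolding s0 s1 g0 g1 K_def[symmetric] by Groebner_Basis.algebra
qed

lemma sum_linear_wz_term: "(\<Sum>k\<le>n. (3 * of_nat k + 1) * wz_term n k) = (-1) ^ n"
proof (induction n)
  case 0
  show ?case by (simp add: wz_term_def)
next
  case (Suc n)
  \<comment> \<open>The certificate relation covers only \<open>k\<close> up to \<open>n\<close>;
    the extra summand of the sum for \<open>n + 1\<close> cancels the boundary value left by the
    telescoping.\<close>
  have last: "(3 * of_nat (n + 1) + 1) * wz_term (n + 1) (n + 1) = wz_cert1 n (n + 1)"
  proof -
    define N :: rat where "N = of_nat n"
    have "N \<ge> 0" by (simp add: N_def)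
    then have nz: "3*N+4 \<noteq> 0" by linarith
    have f1: "fact (3 * n + 4) = (3*N+4) * (fact (3 * n + 3) :: rat)"
      by (simp add: N_def add_ac mult_ac numeral_eq_Suc)
    have f2: "fact (2 * n + 2) = (2*N+2) * (fact (2 * n + 1) :: rat)"
      by (simp add: N_def add_ac)
    have f3: "fact (n + 1) = (N+1) * (fact n :: rat)"
      by (simp add: N_def add_ac)
    have N': "of_nat (n + 1) = N + 1" by (simp add: N_def)
    have e: "n + 1 + (n + 1) = 2 * n + 2" "2 * (n + 1) - (n + 1) = n + 1" "n + 1 - (n + 1) = 0"
       "2 * (n + 1) + 1 + (n + 1) = 3 * n + 4" by auto
    have e': "n + (n + 1) = 2 * n + 1" "2 * n + 1 - (n + 1) = n" "2 * n + 2 + (n + 1) = 3 * n + 3" by auto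
    have s: "(3*N+4) * wz_term (n + 1) (n + 1) = wz_coeff (n + 1) * ((2*N+2) * fact (2 * n + 1)) * ((N+1) * fact n) / fact (3 * n + 3)"
      unfolding wz_term_def e f1 f2 f3 using nz by (simp del: fact_Suc)
    have g: "wz_cert1 n (n + 1) = 2 * (N+1) * (N+1) * wz_coeff (n + 1) * fact (2 * n + 1) * fact n / fact (3 * n + 3)"
      unfolding wz_cert1_def e' N' N_def[symmetric] by simp
    have "3 * (N + 1) + 1 = 3*N+4" "2*N+2 = 2*(N+1)" by simp_all
    then show ?thesis unfolding N' g using s by (simp add: mult_ac add_ac del: fact_Suc distrib_left_numeral)
  qed
  have "(\<Sum>k\<le>n. (3 * of_nat k + 1) * (wz_term (n + 1) k + wz_term n k))
      = (\<Sum>k\<le>n. wz_cert1 n k - wz_cert1 n (k + 1))"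
    using wz_cert1_step by (intro sum.cong) auto
  also have "\<dots> = - wz_cert1 n (n + 1)"
    using sum_telescope[of "wz_cert1 n" n] by (simp add: wz_cert1_def del: power_Suc fact_Suc)
  finally have "(\<Sum>k\<le>n. (3 * of_nat k + 1) * wz_term (n + 1) k) + (-1) ^ n = - wz_cert1 n (n + 1)"
    by (simp add: Suc.IH[symmetric] distrib_left sum.distrib)
  then show ?case using last by (simp add: add.commute)
qed

section \<open>Creative telescoping for the unweighted sum\<close>

definition wz_cert2 :: "nat \<Rightarrow> nat \<Rightarrow> rat" where
  "wz_cert2 n k = (let N = of_nat n; K = of_nat k in
     (- (12 + 26*N + 18*N^2 + 4*N^3) + (84 + 173*N + 117*N^2 + 26*N^3) * K
      - (45 + 84*N + 54*N^2 + 12*N^3) * K^2 + (3 + 2*N) * K^3) * K)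
     * wz_coeff k
     * fact (n + k) * fact (2 * n + 1 - k) / (fact (n + 2 - k) * fact (2 * n + 4 + k))"

text \<open>The weights are the coefficients of the two-step recurrence for the sum. Again
  \<open>n = k + d\<close> and a common factor \<open>h\<close> leave a polynomial identity.\<close>

lemma wz_cert2_step:
  assumes "k \<le> n"
  shows "(3 * of_nat n + 5) * (3 * of_nat n + 7) * wz_term (n + 2) k
           - (3 * of_nat n + 4) * (3 * of_nat n + 2) * wz_term n k = wz_cert2 n (k + 1) - wz_cert2 n k"
proof -
  obtain d where n: "n = k + d" using assms le_Suc_ex by blast
  define K D :: rat where "K = of_nat k" and "D = of_nat d"
  define c :: "rat \<Rightarrow> rat" where "c x = - (12 + 26*(K+D) + 18*(K+D)^2 + 4*(K+D)^3) + (84 + 173*(K+D) + 117*(K+D)^2 + 26*(K+D)^3) * x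
      - (45 + 84*(K+D) + 54*(K+D)^2 + 12*(K+D)^3) * x^2 + (3 + 2*(K+D)) * x^3" for x
  define b where "b = wz_coeff k"
  define h :: rat where "h = b * fact (2 * k + d) * fact (k + 2 * d)
     / (fact (d + 2) * fact (3 * k + 2 * d + 5))"
  have N: "of_nat n = K + D" by (simp add: n K_def D_def)
  have pos: "K \<ge> 0" "D \<ge> 0" by (simp_all add: K_def D_def)
  then have nz: "D + 1 \<noteq> 0" "D + 2 \<noteq> 0" "K + 1 \<noteq> 0" "3*K+2*D+2 \<noteq> 0" "3*K+2*D+3 \<noteq> 0" "3*K+2*D+4 \<noteq> 0" "3*K+2*D+5 \<noteq> 0" by linarith+
  have b': "wz_coeff (k + 1) = -4 * (2*K+1) / (K+1) * b"
    using wz_coeff_Suc[of k] by (simp add: b_def K_def)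
  have f1': "fact (d + 2) = (D + 2) * (fact (d+1) :: rat)" by (simp add: D_def)
  have f1: "fact (d + 2) = (D + 2) * (D + 1) * (fact d :: rat)" by (simp add: D_def add_ac mult_ac)
  have f2: "fact (2 * k + d + 1) = (2*K+D+1) * (fact (2 * k + d) :: rat)" by (simp add: D_def K_def add_ac)
  have f2b: "fact (2 * k + d + 2) = (2*K+D+2) * (2*K+D+1) * (fact (2 * k + d) :: rat)" by (simp add: D_def K_def add_ac)
  have f2': "fact (k + 2 * d + 1) = (K+2*D+1) * (fact (k + 2 * d) :: rat)" by (simp add: D_def K_def add_ac)
  have f2'': "fact (k + 2 * d + 4) = (K+2*D+4) * (K+2*D+3) * (K+2*D+2) * (K+2*D+1) * (fact (k + 2 * d) :: rat)"
    by (simp add: D_def K_def numeral_eq_Suc add_ac mult_ac)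
  have f3': "fact (3 * k + 2 * d + 5) = (3*K+2*D+5) * (fact (3 * k + 2 * d + 4) :: rat)"
    by (simp add: D_def K_def add_ac numeral_eq_Suc)
  have f3: "fact (3 * k + 2 * d + 5) = (3*K+2*D+5) * (3*K+2*D+4) * (3*K+2*D+3) * (3*K+2*D+2) * (fact (3 * k + 2 * d + 1) :: rat)"
    by (simp add: D_def K_def add_ac mult_ac numeral_eq_Suc)
  have s0: "wz_term n k = (D+2) * (D+1) * ((3*K+2*D+5) * (3*K+2*D+4) * (3*K+2*D+3) * (3*K+2*D+2)) * h"
  proof -
    have e: "n + k = 2 * k + d" "2 * n - k = k + 2 * d" "n - k = d" "2 * n + 1 + k = 3 * k + 2 * d + 1"
      using n by auto
    have "(D+2) * (D+1) \<noteq> 0" "(3*K+2*D+5) * (3*K+2*D+4) * (3*K+2*D+3) * (3*K+2*D+2) \<noteq> 0"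
      using nz by simp_all
    from expand_fraction[OF this] show ?thesis
      unfolding wz_term_def h_def f1 f3 e b_def by blast
  qed
  have s1: "wz_term (n+2) k = (2*K+D+2) * (2*K+D+1) * ((K+2*D+4) * (K+2*D+3) * (K+2*D+2) * (K+2*D+1)) * h"
  proof -
    have e: "n + 2 + k = 2 * k + d + 2" "2 * (n + 2) - k = k + 2 * d + 4" "n + 2 - k = d + 2"
       "2 * (n + 2) + 1 + k = 3 * k + 2 * d + 5"
      using n by auto
    show ?thesis unfolding wz_term_def h_def f2b f2'' e b_def by (simp add: mult_ac)
  qed
  have g0: "wz_cert2 n k = c K * K * (K+2*D+1) * (3*K+2*D+5) * h"
  proof -
    have e: "n + k = 2 * k + d" "2 * n + 1 - k = k + 2 * d + 1" "n + 2 - k = d + 2" "2 * n + 4 + k = 3 * k + 2 * d + 4"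
      using n by auto
    show ?thesis using nz(7)
      unfolding wz_cert2_def Let_def N K_def[symmetric] c_def[symmetric] e b_def[symmetric] h_def f2' f3'
      by (simp add: mult_ac del: fact_Suc)
  qed
  have g1: "wz_cert2 n (k+1) = c (K+1) * (-4*(2*K+1)) * (2*K+D+1) * (D+2) * h"
  proof -
    have K': "of_nat (k + 1) = K + 1" by (simp add: K_def)
    have e: "n + (k + 1) = 2 * k + d + 1" "2 * n + 1 - (k + 1) = k + 2 * d" "n + 2 - (k + 1) = d + 1" "2 * n + 4 + (k + 1) = 3 * k + 2 * d + 5"
      using n by auto
    show ?thesis using nz(2,3)
      unfolding wz_cert2_def Let_def N K' c_def[symmetric] e b' h_def f2 f1'
      by (simp add: mult_ac del: fact_Suc)
  qed
  have poly: "(3*(K+D)+5) * (3*(K+D)+7) * ((2*K+D+2) * (2*K+D+1) * ((K+2*D+4) * (K+2*D+3) * (K+2*D+2) * (K+2*D+1)))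
     - (3*(K+D)+4) * (3*(K+D)+2) * ((D+2) * (D+1) * ((3*K+2*D+5) * (3*K+2*D+4) * (3*K+2*D+3) * (3*K+2*D+2)))
     = c (K+1) * (-4*(2*K+1)) * (2*K+D+1) * (D+2) - c K * K * (K+2*D+1) * (3*K+2*D+5)"
    unfolding c_def by Groebner_Basis.algebra
  have "a * (x * h) - b * (y * h) = z * h - w * h" if "a * x - b * y = z - w" for a b x y z w
    using arg_cong[OF that, of "\<lambda>t. t * h"] by (simp add: left_diff_distrib mult.assoc)
  from this[OF poly] show ?thesis unfolding s0 s1 g0 g1 N .
qed

text \<open>The sum for \<open>n + 2\<close> has two summands beyond the telescoping range; with
  their weight they cancel its boundary value.\<close>

lemma wz_cert2_last:
  "(3 * of_nat n + 5) * (3 * of_nat n + 7) * (wz_term (n + 2) (n + 1) + wz_term (n + 2) (n + 2))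
     + wz_cert2 n (n + 1) = 0"
proof -
  define N :: rat where "N = of_nat n"
  define b where "b = wz_coeff (n + 1)"
  define h :: rat where "h = b * fact (2 * n + 1) * fact n / fact (3 * n + 7)"
  have "N \<ge> 0" by (simp add: N_def)
  then have nz: "N + 2 \<noteq> 0" "3*N+6 \<noteq> 0" "3*N+7 \<noteq> 0" by linarith+
  have b': "wz_coeff (n + 2) = -4 * (2*N+3) / (N+2) * b"
    using wz_coeff_Suc[of "n+1"] by (simp add: b_def N_def add_ac)
  have f1: "fact (3 * n + 7) = (3*N+7) * (3*N+6) * (fact (3 * n + 5) :: rat)"
    by (simp add: N_def add_ac mult_ac numeral_eq_Suc)
  have f1': "fact (3 * n + 7) = (3*N+7) * (fact (3 * n + 6) :: rat)"
    by (simp add: N_def add_ac mult_ac numeral_eq_Suc)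
  have f2: "fact (2 * n + 3) = (2*N+3) * (2*N+2) * (fact (2 * n + 1) :: rat)"
    by (simp add: N_def add_ac mult_ac numeral_eq_Suc)
  have f2': "fact (2 * n + 4) = (2*N+4) * (2*N+3) * (2*N+2) * (fact (2 * n + 1) :: rat)"
    by (simp add: N_def add_ac mult_ac numeral_eq_Suc)
  have f3: "fact (n + 3) = (N+3) * (N+2) * (N+1) * (fact n :: rat)"
    by (simp add: N_def add_ac mult_ac numeral_eq_Suc)
  have f3': "fact (n + 2) = (N+2) * (N+1) * (fact n :: rat)"
    by (simp add: N_def add_ac mult_ac numeral_eq_Suc)
  have s1: "wz_term (n + 2) (n + 1) = (2*N+3) * (2*N+2) * (N+3) * (N+2) * (N+1) * (3*N+7) * h"
  proof -
    have e: "n + 2 + (n + 1) = 2 * n + 3" "2 * (n + 2) - (n + 1) = n + 3" "n + 2 - (n + 1) = 1"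
       "2 * (n + 2) + 1 + (n + 1) = 3 * n + 6" by auto
    show ?thesis using nz(3) unfolding wz_term_def e h_def b_def f1' f2 f3 by simp
  qed
  have s2: "wz_term (n + 2) (n + 2) = -4 * (2*N+3) * (2*N+4) * (2*N+3) * (2*N+2) * (N+1) * h"
  proof -
    have e: "n + 2 + (n + 2) = 2 * n + 4" "2 * (n + 2) - (n + 2) = n + 2" "n + 2 - (n + 2) = 0"
       "2 * (n + 2) + 1 + (n + 2) = 3 * n + 7" by auto
    show ?thesis using nz(1) unfolding wz_term_def e h_def b' f2' f3' by simp
  qed
  have g: "wz_cert2 n (n + 1) = (- (12 + 26*N + 18*N^2 + 4*N^3) + (84 + 173*N + 117*N^2 + 26*N^3) * (N+1)
      - (45 + 84*N + 54*N^2 + 12*N^3) * (N+1)^2 + (3 + 2*N) * (N+1)^3) * (N+1) * ((3*N+7) * (3*N+6)) * h"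
    (is "_ = ?c * _ * _ * _")
  proof -
    define c where "c = ?c"
    have N': "of_nat (n + 1) = N + 1" by (simp add: N_def)
    have e: "n + (n + 1) = 2 * n + 1" "2 * n + 1 - (n + 1) = n" "n + 2 - (n + 1) = 1" "2 * n + 4 + (n + 1) = 3 * n + 5"
      by auto
    have "(3*N+7) * (3*N+6) \<noteq> 0" using nz by simp
    then show ?thesis
      unfolding wz_cert2_def Let_def N' N_def[symmetric] c_def[symmetric] e b_def[symmetric] h_def f1
      by (simp add: mult_ac del: fact_Suc)
  qed
  show ?thesis unfolding s1 s2 g N_def[symmetric] by Groebner_Basis.algebra
qed

lemma sum_wz_term_recurrence:
  "(3 * of_nat n + 5) * (3 * of_nat n + 7) * (\<Sum>k\<le>n + 2. wz_term (n + 2) k)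
     = (3 * of_nat n + 4) * (3 * of_nat n + 2) * (\<Sum>k\<le>n. wz_term n k)"
proof -
  have "(\<Sum>k\<le>n. (3 * of_nat n + 5) * (3 * of_nat n + 7) * wz_term (n + 2) k
           - (3 * of_nat n + 4) * (3 * of_nat n + 2) * wz_term n k)
      = (\<Sum>k\<le>n. wz_cert2 n (k + 1) - wz_cert2 n k)"
    using wz_cert2_step by (intro sum.cong) auto
  also have "\<dots> = wz_cert2 n (n + 1) - wz_cert2 n 0"
    using sum_lessThan_telescope[of "wz_cert2 n" "n + 1"] by (simp add: lessThan_Suc_atMost)
  also have "wz_cert2 n 0 = 0" by (simp add: wz_cert2_def)
  finally have "(3 * of_nat n + 5) * (3 * of_nat n + 7) * (\<Sum>k\<le>n. wz_term (n + 2) k)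
      - (3 * of_nat n + 4) * (3 * of_nat n + 2) * (\<Sum>k\<le>n. wz_term n k) = wz_cert2 n (n + 1)"
    by (simp only: sum_subtractf sum_distrib_left[symmetric] diff_zero)
  moreover have "(\<Sum>k\<le>n + 2. wz_term (n + 2) k)
      = (\<Sum>k\<le>n. wz_term (n + 2) k) + (wz_term (n + 2) (n + 1) + wz_term (n + 2) (n + 2))"
    by simp
  moreover have "x * u = y * t" if "x * s - y * t = g" "u = s + v" "x * v + g = 0" for x y s t g u v :: rat
    using that by (simp add: distrib_left)
  ultimately show ?thesis using wz_cert2_last[of n] by blast
qed

text \<open>The recurrence is homogeneous with a nonzero leading coefficient, so the zero at
  \<open>n = 1\<close> propagates to all odd \<open>n\<close>.\<close>

lemma sum_wz_term_odd: "(\<Sum>k\<le>2 * m + 1. wz_term (2 * m + 1) k) = 0"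
proof (induction m)
  case 0
  show ?case by (simp add: wz_term_def wz_coeff_def numeral_eq_Suc)
next
  case (Suc m)
  have "(3 * of_nat (2 * m + 1) + 5 :: rat) \<noteq> 0" "(3 * of_nat (2 * m + 1) + 7 :: rat) \<noteq> 0"
    using of_nat_0_le_iff[of "2 * m + 1", where ?'a = rat] by linarith+
  moreover have "2 * Suc m + 1 = 2 * m + 1 + 2" by simp
  ultimately show ?case using sum_wz_term_recurrence[of "2 * m + 1"]
    by (simp only: Suc.IH mult_zero_right mult_eq_0_iff) simp
qed

text \<open>Along even \<open>n\<close> the recurrence has order one in \<open>m\<close>, and the
  binomial coefficients on both sides change by matching rational factors.\<close>

lemma sum_wz_term_even:
  "of_nat (6 * m + 1) * of_nat ((6 * m) choose (3 * m)) * (\<Sum>k\<le>2 * m. wz_term (2 * m) k)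
     = 16 ^ m * of_nat ((2 * m) choose m)"
proof (induction m)
  case 0
  show ?case by (simp add: wz_term_def)
next
  case (Suc m)
  define M :: rat where "M = of_nat m"
  define S where "S = (\<Sum>k\<le>2 * m. wz_term (2 * m) k)"
  define S' where "S' = (\<Sum>k\<le>2 * m + 2. wz_term (2 * m + 2) k)"
  define c where "c = (of_nat ((6 * m) choose (3 * m)) :: rat)"
  define e where "e = (of_nat ((2 * m) choose m) :: rat)"
  have "M \<ge> 0" by (simp add: M_def)
  then have nz: "M + 1 \<noteq> 0" "3*M+1 \<noteq> 0" "3*M+2 \<noteq> 0" "3*M+3 \<noteq> 0" by linarith+
  have rec: "(6*M+5) * (6*M+7) * S' = (6*M+4) * (6*M+2) * S"
    using sum_wz_term_recurrence[of "2 * m"] by (simp add: S_def S'_def M_def)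
  have IH: "(6*M+1) * c * S = 16 ^ m * e"
    using Suc.IH by (simp add: M_def c_def S_def e_def add_ac)
  have "of_nat (2 * (3 * m + 1) choose (3 * m + 1)) = 2 * (2 * (3*M) + 1) / (3*M+1) * c"
    using central_binomial_Suc[of "3 * m"] by (simp only: c_def M_def) simp
  then have "of_nat (2 * (3 * m + 2) choose (3 * m + 2)) = 2 * (2 * (3*M+1) + 1) / (3*M+2) * (2 * (2 * (3*M) + 1) / (3*M+1) * c)"
    using central_binomial_Suc[of "3 * m + 1"] by (simp only: M_def) (simp del: binomial_Suc_Suc add: add_ac)
  then have "of_nat (2 * (3 * m + 3) choose (3 * m + 3))
     = 2 * (2 * (3*M+2) + 1) / (3*M+3) * (2 * (2 * (3*M+1) + 1) / (3*M+2) * (2 * (2 * (3*M) + 1) / (3*M+1) * c))"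
    using central_binomial_Suc[of "3 * m + 2"] by (simp only: M_def) (simp del: binomial_Suc_Suc add: add_ac numeral_3_eq_3)
  then have c': "of_nat (6 * Suc m choose (3 * Suc m)) * ((3*M+3) * (3*M+2) * (3*M+1)) = 8 * (6*M+5) * (6*M+3) * (6*M+1) * c"
    using nz by (simp del: binomial_Suc_Suc add: add_ac) (simp add: algebra_simps)
  have e': "of_nat (2 * Suc m choose Suc m) * (M + 1) = 2 * (2 * M + 1) * e"
    using central_binomial_Suc[of m] nz(1) by (simp add: M_def e_def del: binomial_Suc_Suc)
  define C' E' where "C' = (of_nat (6 * Suc m choose (3 * Suc m)) :: rat)" and "E' = (of_nat (2 * Suc m choose Suc m) :: rat)"
  have *: "6*M+5 \<noteq> 0" using \<open>M \<ge> 0\<close> by linarith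
  \<comment> \<open>Both sides are multiplied by the denominators of the binomial ratios and by a
    leading factor of the recurrence; all of these are nonzero and cancel at the end.\<close>
  have "((6*M+5) * ((3*M+3) * (3*M+2) * (3*M+1)) * (M+1)) * ((6*M+7) * C' * S')
      = (C' * ((3*M+3) * (3*M+2) * (3*M+1))) * ((6*M+5) * (6*M+7) * S') * (M+1)"
    by (simp only: mult_ac)
  also have "\<dots> = 8 * (6*M+5) * (6*M+3) * (6*M+4) * (6*M+2) * (M+1) * ((6*M+1) * c * S)"
    unfolding c'[folded C'_def] rec by (simp only: mult_ac)
  also have "\<dots> = ((6*M+5) * ((3*M+3) * (3*M+2) * (3*M+1))) * 16 * 16 ^ m * (2 * (2*M+1) * e)"
    unfolding IH by Groebner_Basis.algebra
  also have "\<dots> = ((6*M+5) * ((3*M+3) * (3*M+2) * (3*M+1)) * (M+1)) * (16 * 16 ^ m * E')"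
    unfolding e'[folded E'_def, symmetric] by (simp only: mult_ac)
  finally have "(6*M+7) * C' * S' = 16 * 16 ^ m * E'"
    using nz * by simp
  moreover have "of_nat (6 * Suc m + 1) = 6*M+7" by (simp add: M_def)
  moreover have "2 * Suc m = 2 * m + 2" by simp
  ultimately show ?case unfolding C'_def E'_def S'_def by (simp only: power_Suc)
qed

section \<open>Jacobsthal sums\<close>

locale odd_prime =
  fixes p :: nat
  assumes prime: "prime p" and gt_2: "p > 2"
begin

section \<open>Legendre symbols and elementary character sums\<close>

abbreviation chi :: "int \<Rightarrow> int" where "chi a \<equiv> Legendre a (int p)"

abbreviation (input) residue_system :: "int set" where "residue_system \<equiv> {0..<int p}"

lemma prime_int: "prime (int p)"
  using prime by simp

text \<open>The map t -> k t + l permutes the residues modulo \<open>p\<close>, since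
  \<open>k\<close> is invertible.\<close>

lemma sum_residues_affine:
  fixes F :: "int \<Rightarrow> 'a::comm_monoid_add"
  assumes "\<And>s t. [s = t] (mod int p) \<Longrightarrow> F s = F t" and "\<not> int p dvd k"
  shows "(\<Sum>t\<in>residue_system. F (k * t + l)) = (\<Sum>t\<in>residue_system. F t)"
proof -
  define h where "h t = (k * t + l) mod int p" for t
  have cop: "coprime k (int p)"
    using assms(2) prime_int prime_imp_coprime coprime_commute by blast
  have "inj_on h residue_system"
  proof (rule inj_onI)
    fix s t assume st: "s \<in> residue_system" "t \<in> residue_system" "h s = h t"
    then have "[k * s + l = k * t + l] (mod int p)" by (simp add: h_def cong_def)
    then have "[s = t] (mod int p)"
      using cop by (simp add: cong_add_rcancel cong_mult_lcancel)
    then show "s = t" using st by (simp add: cong_def)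
  qed
  moreover have "h ` residue_system \<subseteq> residue_system" using gt_2 by (auto simp: h_def)
  ultimately have "bij_betw h residue_system residue_system"
    by (simp add: bij_betw_def endo_inj_surj)
  then have "(\<Sum>t\<in>residue_system. F (h t)) = (\<Sum>t\<in>residue_system. F t)"
    by (rule sum.reindex_bij_betw)
  moreover have "F (h t) = F (k * t + l)" for t
    by (rule assms(1)) (simp add: h_def cong_def)
  ultimately show ?thesis by simp
qed

lemma chi_cong: "[a = b] (mod int p) \<Longrightarrow> chi a = chi b"
  unfolding Legendre_def QuadRes_def by (simp add: cong_def)

lemma chi_cases: "chi a = -1 \<or> chi a = 0 \<or> chi a = 1"
  by (auto simp: Legendre_def)

lemma chi_eq_0_iff: "chi a = 0 \<longleftrightarrow> int p dvd a"
  by (auto simp: Legendre_def cong_0_iff)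

lemma chi_euler: "[chi a = a ^ ((p - 1) div 2)] (mod int p)"
  using euler_criterion[OF prime gt_2] .

text \<open>Two elements of {-1, 0, 1} differ by at most 2, which is less than \<open>p\<close>;
  congruences between symbols are therefore equalities.\<close>

lemma chi_unique:
  assumes "[u = v] (mod int p)" "u = -1 \<or> u = 0 \<or> u = 1" "v = -1 \<or> v = 0 \<or> v = 1"
  shows "u = v"
proof -
  have d: "int p dvd u - v" using assms(1) by (simp add: cong_iff_dvd_diff)
  have "\<bar>u - v\<bar> \<le> 2" using assms(2,3) by auto
  then show ?thesis using d zdvd_imp_le[of "int p" "\<bar>u - v\<bar>"] gt_2 by fastforce
qed

lemma chi_mult: "chi (a * b) = chi a * chi b"
proof (rule chi_unique)
  have "[chi a * chi b = a ^ ((p - 1) div 2) * b ^ ((p - 1) div 2)] (mod int p)"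
    by (intro cong_mult chi_euler)
  then show "[chi (a * b) = chi a * chi b] (mod int p)"
    using chi_euler[of "a * b"] by (metis cong_sym cong_trans power_mult_distrib)
  show "chi a * chi b = -1 \<or> chi a * chi b = 0 \<or> chi a * chi b = 1"
    using chi_cases[of a] chi_cases[of b] by auto
qed (rule chi_cases)

lemma chi_square: "\<not> int p dvd a \<Longrightarrow> chi (a\<^sup>2) = 1"
  using chi_cases[of a] chi_eq_0_iff[of a] by (auto simp: power2_eq_square chi_mult)

lemma chi_nonzero_sq: "\<not> int p dvd a \<Longrightarrow> chi a * chi a = 1"
  using chi_cases[of a] chi_eq_0_iff[of a] by auto

lemma chi_eq_1: assumes "chi a = 1" obtains k where "[k\<^sup>2 = a] (mod int p)" "\<not> int p dvd k"
proof -
  obtain k where k: "[k\<^sup>2 = a] (mod int p)"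
    using assms unfolding Legendre_def QuadRes_def by (auto split: if_splits)
  moreover have "\<not> int p dvd k"
  proof
    assume "int p dvd k"
    then have "int p dvd a" using k by (metis cong_dvd_iff dvd_power zero_less_numeral dvd_trans)
    then show False using assms chi_eq_0_iff[of a] by simp
  qed
  ultimately show ?thesis using that by blast
qed

lemma primitive_root_exists:
  obtains g :: int where "\<And>e. [g ^ e = 1] (mod int p) \<longleftrightarrow> (p - 1) dvd e"
proof -
  obtain g where g: "residue_primroot p g"
    using prime_primitive_root_exists[of p] prime gt_2 prime_gt_1_nat by blast
  then have "ord p g = p - 1"
    using prime by (simp add: residue_primroot_def totient_prime)
  then have "[int g ^ e = 1] (mod int p) \<longleftrightarrow> (p - 1) dvd e" for e
    using ord_divides[of g e p] cong_int_iff[of "g ^ e" 1 p] by simp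
  then show ?thesis using that by blast
qed

lemma nonresidue_exists: obtains g where "chi g = -1"
proof -
  obtain g :: int where g: "\<And>e. [g ^ e = 1] (mod int p) \<longleftrightarrow> (p - 1) dvd e"
    using primitive_root_exists by blast
  \<comment> \<open>A primitive root is a nonresidue: by Euler's criterion its symbol is 1 only if
    \<open>p - 1\<close> divides \<open>(p - 1) div 2\<close>.\<close>
  have "\<not> (p - 1) dvd (p - 1) div 2" using gt_2 by (auto dest!: dvd_imp_le)
  then have n1: "chi g \<noteq> 1" using g chi_euler[of g] by (metis cong_sym)
  have "[g ^ (p - 1) = 1] (mod int p)" using g by simp
  then have "\<not> int p dvd g"
    by (metis cong_dvd_iff dvd_power gt_2 not_prime_unit prime_int zero_less_diff less_trans one_less_numeral_iff semiring_norm(76) dvd_trans)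
  then show ?thesis using n1 chi_cases[of g] chi_eq_0_iff[of g] that by auto
qed

text \<open>Scaling by a nonresidue permutes the summands and changes the sign of the sum.\<close>

lemma sum_chi: "(\<Sum>t\<in>residue_system. chi t) = 0"
proof -
  obtain g where g: "chi g = -1" using nonresidue_exists .
  then have "\<not> int p dvd g" using chi_eq_0_iff[of g] by simp
  then have "(\<Sum>t\<in>residue_system. chi (g * t + 0)) = (\<Sum>t\<in>residue_system. chi t)"
    by (intro sum_residues_affine chi_cong)
  then show ?thesis using g by (simp add: chi_mult sum_negf)
qed

lemma sum_chi_sq: "(\<Sum>t\<in>residue_system. chi t * chi t) = int p - 1"
proof -
  have "(\<Sum>t\<in>residue_system. chi t * chi t) = (\<Sum>t\<in>residue_system. if t = 0 then 0 else 1)"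
  proof (intro sum.cong refl)
    fix t assume "t \<in> residue_system"
    then have "int p dvd t \<longleftrightarrow> t = 0" using zdvd_not_zless[of t "int p"] by fastforce
    then show "chi t * chi t = (if t = 0 then 0 else 1)"
      using chi_nonzero_sq[of t] chi_eq_0_iff[of t] by auto
  qed
  also have "\<dots> = (\<Sum>t\<in>residue_system. 1 - (if t = 0 then 1 else 0))" by (intro sum.cong) auto
  also have "\<dots> = int p - 1" using gt_2 by (simp add: sum_subtractf)
  finally show ?thesis .
qed

text \<open>Scaling \<open>c\<close> by \<open>d\<close> shows that the sum has the same value
  \<open>K\<close> for all nonzero \<open>d\<close>. Summed over all residues \<open>d\<close> the
  total is 0, while \<open>d = 0\<close> contributes p - 1; hence (p - 1)(1 + K) = 0.\<close>

lemma sum_chi_shift: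
  assumes "\<not> int p dvd d"
  shows "(\<Sum>c\<in>residue_system. chi c * chi (c + d)) = -1"
proof -
  define K where "K = (\<Sum>c\<in>residue_system. chi c * chi (c + 1))"
  have eq: "(\<Sum>c\<in>residue_system. chi c * chi (c + d)) = K" if d: "\<not> int p dvd d" for d
  proof -
    have "(\<Sum>c\<in>residue_system. chi (d * c + 0) * chi (d * c + 0 + d)) = (\<Sum>c\<in>residue_system. chi c * chi (c + d))"
      by (intro sum_residues_affine[where F = "\<lambda>c. chi c * chi (c + d)"] d)
         (metis chi_cong cong_add_rcancel)
    moreover have "chi (d * c + 0) * chi (d * c + 0 + d) = chi c * chi (c + 1)" for c
    proof -
      have "d * c + 0 + d = d * (c + 1)" by (simp add: algebra_simps)
      then have "chi (d * c + 0) * chi (d * c + 0 + d) = (chi d * chi d) * (chi c * chi (c + 1))"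
        by (simp only: chi_mult add_0_right mult_ac)
      then show ?thesis using chi_nonzero_sq[OF d] by simp
    qed
    ultimately show ?thesis by (simp add: K_def)
  qed
  have "(\<Sum>d\<in>residue_system. \<Sum>c\<in>residue_system. chi c * chi (c + d)) = (\<Sum>c\<in>residue_system. chi c * (\<Sum>d\<in>residue_system. chi (c + d)))"
    by (subst sum.swap) (simp add: sum_distrib_left)
  also have "\<dots> = 0"
  proof -
    have "(\<Sum>d\<in>residue_system. chi (c + d)) = 0" for c
      using sum_residues_affine[where F = chi and k = 1 and l = c, OF chi_cong] sum_chi prime_int
      gt_2 by (simp add: add.commute not_prime_unit)
    then show ?thesis by simp
  qed
  finally have "(\<Sum>d\<in>residue_system. \<Sum>c\<in>residue_system. chi c * chi (c + d)) = 0" .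
  moreover have "(\<Sum>d\<in>residue_system. \<Sum>c\<in>residue_system. chi c * chi (c + d)) = (int p - 1) + (\<Sum>d\<in>{1..<int p}. K)"
  proof -
    define f where "f d = (\<Sum>c\<in>residue_system. chi c * chi (c + d))" for d
    have "residue_system = insert 0 {1..<int p}" using gt_2 by auto
    then have "(\<Sum>d\<in>residue_system. f d) = f 0 + (\<Sum>d\<in>{1..<int p}. f d)" by simp
    moreover have "f 0 = int p - 1" using sum_chi_sq by (simp add: f_def)
    moreover
    have "(\<Sum>d\<in>{1..<int p}. \<Sum>c\<in>residue_system. chi c * chi (c + d)) = (\<Sum>d\<in>{1..<int p}. K)"
      by (intro sum.cong refl eq) (auto dest: zdvd_imp_le)
    ultimately show ?thesis by (simp add: f_def)
  qed
  moreover have "(\<Sum>d\<in>{1..<int p}. K) = (int p - 1) * K" using gt_2 by simp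
  ultimately have "(int p - 1) * (1 + K) = 0" by (simp only: distrib_left mult_1_right)
  then have "K = -1" using gt_2 by auto
  then show ?thesis using eq[OF assms] by simp
qed

section \<open>Jacobsthal sums and the representation of p as a sum of two squares\<close>

definition jacobsthal :: "int \<Rightarrow> int" where
  "jacobsthal c = (\<Sum>t\<in>residue_system. chi t * chi (t\<^sup>2 + c))"

lemma jacobsthal_cong: "[a = b] (mod int p) \<Longrightarrow> jacobsthal a = jacobsthal b"
  unfolding jacobsthal_def by (intro sum.cong arg_cong2[where f = times] refl chi_cong cong_add) auto

lemma jacobsthal_0: "jacobsthal 0 = 0"
proof -
  have "chi t * chi (t\<^sup>2 + 0) = chi t" for t
    using chi_square[of t] chi_eq_0_iff[of t] by (cases "int p dvd t") auto
  then show ?thesis unfolding jacobsthal_def by (simp only: sum_chi)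
qed

text \<open>Substitute t -> k t and pull the square of \<open>k\<close> out of the second
  symbol.\<close>

lemma jacobsthal_mult_square:
  assumes "\<not> int p dvd k"
  shows "jacobsthal (c * k\<^sup>2) = chi k * jacobsthal c"
proof -
  have "(\<Sum>t\<in>residue_system. chi (k * t + 0) * chi ((k * t + 0)\<^sup>2 + c * k\<^sup>2)) = jacobsthal (c * k\<^sup>2)"
    unfolding jacobsthal_def
    by (intro sum_residues_affine[where F = "\<lambda>t. chi t * chi (t\<^sup>2 + c * k\<^sup>2)"] assms)
       (metis chi_cong cong_add_rcancel cong_pow)
  moreover have "chi (k * t + 0) * chi ((k * t + 0)\<^sup>2 + c * k\<^sup>2) = chi k * (chi t * chi (t\<^sup>2 + c))" for t
  proof -
    have "(k * t + 0)\<^sup>2 + c * k\<^sup>2 = k\<^sup>2 * (t\<^sup>2 + c)" by (simp add: algebra_simps power2_eq_square)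
    then show ?thesis using chi_square[OF assms] by (simp add: chi_mult)
  qed
  ultimately show ?thesis by (simp add: jacobsthal_def sum_distrib_left)
qed

text \<open>Equal nonzero symbols make \<open>c * d\<close> a square modulo \<open>p\<close>, so
  \<open>c\<close> and \<open>d\<close> differ by a square factor, which affects the sum by a sign
  only.\<close>

lemma jacobsthal_sq_residue:
  assumes "chi c = chi d" "chi d \<noteq> 0"
  shows "(jacobsthal c)\<^sup>2 = (jacobsthal d)\<^sup>2"
proof -
  have "chi (c * d) = 1" using assms chi_cases[of d] by (auto simp: chi_mult)
  then obtain k where k: "[k\<^sup>2 = c * d] (mod int p)" "\<not> int p dvd k" using chi_eq_1 by blast
  have nd: "\<not> int p dvd d" using assms chi_eq_0_iff by auto
  have "[c * d\<^sup>2 = d * k\<^sup>2] (mod int p)"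
    using cong_scalar_left[OF k(1), of d] by (simp add: power2_eq_square mult_ac cong_sym_eq)
  then have "chi d * jacobsthal c = chi k * jacobsthal d"
    using jacobsthal_cong jacobsthal_mult_square[OF nd, of c] jacobsthal_mult_square[OF k(2), of d] by metis
  then have "(chi d * chi d) * (jacobsthal c)\<^sup>2 = (chi k * chi k) * (jacobsthal d)\<^sup>2"
    by (metis power2_eq_square power_mult_distrib)
  then show ?thesis using chi_nonzero_sq[OF nd] chi_nonzero_sq[OF k(2)] by simp
qed

text \<open>Expand the square into a double sum over \<open>s\<close>, \<open>t\<close> and sum over
  \<open>c\<close> first. The inner sum is -1, plus p if s^2 = t^2 modulo p; the -1 contributes
  nothing because the symbols sum to zero, and for nonzero s the rest comes from t = s and t =
  -s.\<close>

lemma sum_jacobsthal_sq: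
  assumes "chi (-1) = 1"
  shows "(\<Sum>c\<in>residue_system. (jacobsthal c)\<^sup>2) = 2 * int p * (int p - 1)"
proof -
  have inner: "(\<Sum>c\<in>residue_system. chi (s\<^sup>2 + c) * chi (t\<^sup>2 + c)) = (if [s\<^sup>2 = t\<^sup>2] (mod int p) then int p else 0) - 1" for s t
  proof -
    have np: "\<not> int p dvd 1" using prime_int not_prime_unit by blast
    have "(\<Sum>c\<in>residue_system. chi (1 * c + s\<^sup>2) * chi (1 * c + s\<^sup>2 + (t\<^sup>2 - s\<^sup>2))) = (\<Sum>c\<in>residue_system. chi c * chi (c + (t\<^sup>2 - s\<^sup>2)))"
      by (intro sum_residues_affine[where F = "\<lambda>c. chi c * chi (c + (t\<^sup>2 - s\<^sup>2))"] np)
         (metis chi_cong cong_add_rcancel)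
    then have *: "(\<Sum>c\<in>residue_system. chi (s\<^sup>2 + c) * chi (t\<^sup>2 + c)) = (\<Sum>c\<in>residue_system. chi c * chi (c + (t\<^sup>2 - s\<^sup>2)))"
      by (simp add: algebra_simps)
    show ?thesis
    proof (cases "int p dvd t\<^sup>2 - s\<^sup>2")
      case True
      then have "chi (c + (t\<^sup>2 - s\<^sup>2)) = chi c" for c
        by (intro chi_cong) (simp add: cong_iff_dvd_diff)
      moreover have "[s\<^sup>2 = t\<^sup>2] (mod int p)" using True cong_iff_dvd_diff cong_sym by blast
      ultimately show ?thesis using * sum_chi_sq by simp
    next
      case False
      moreover have "\<not> [s\<^sup>2 = t\<^sup>2] (mod int p)" using False cong_iff_dvd_diff cong_sym by blast
      ultimately show ?thesis using * sum_chi_shift by simp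
    qed
  qed
  have diag: "(\<Sum>t\<in>residue_system. chi s * chi t * (if [s\<^sup>2 = t\<^sup>2] (mod int p) then int p else 0)) = (if s = 0 then 0 else 2 * int p)"
    if s: "s \<in> residue_system" for s
  proof (cases "s = 0")
    case True
    then show ?thesis using chi_eq_0_iff[of 0] by simp
  next
    case False
    have nds: "\<not> int p dvd s" using False s zdvd_not_zless[of s "int p"] by fastforce
    have iff: "[s\<^sup>2 = t\<^sup>2] (mod int p) \<longleftrightarrow> t = s \<or> t = int p - s" if t: "t \<in> residue_system" for t
    proof -
      have "[s\<^sup>2 = t\<^sup>2] (mod int p) \<longleftrightarrow> int p dvd (s - t) * (s + t)"
        by (simp add: cong_iff_dvd_diff power2_eq_square algebra_simps)
      also have "\<dots> \<longleftrightarrow> int p dvd s - t \<or> int p dvd s + t"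
        using prime_int by (simp add: prime_dvd_mult_iff)
      also have "int p dvd s - t \<longleftrightarrow> t = s"
      proof
        assume "int p dvd s - t"
        then have "[s = t] (mod int p)" by (simp add: cong_iff_dvd_diff)
        then show "t = s" using s t by (simp add: cong_def)
      qed simp
      also have "int p dvd s + t \<longleftrightarrow> t = int p - s"
      proof
        assume "int p dvd s + t"
        then have "[t = int p - s] (mod int p)"
          by (simp add: cong_iff_dvd_diff) (metis add.commute dvd_diff dvd_refl add_diff_eq diff_diff_eq2)
        then show "t = int p - s" using s t False by (intro cong_less_imp_eq_int[of t "int p"]) auto
      qed simp
      finally show ?thesis .
    qed
    have ne: "int p - s \<noteq> s"
    proof
      assume "int p - s = s"
      then have "int p dvd 2 * s" by (simp add: algebra_simps)
      then have "int p dvd 2" using prime_int nds by (simp add: prime_dvd_mult_iff)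
      then show False using gt_2 zdvd_imp_le by fastforce
    qed
    \<comment> \<open>Here \<open>chi (-1) = 1\<close> enters: both square roots contribute with the
      same sign.\<close>
    have "chi (int p - s) = chi ((-1) * s)" by (intro chi_cong) (simp add: cong_iff_dvd_diff)
    then have cs: "chi s * chi (int p - s) = 1" using assms chi_nonzero_sq[OF nds] by (simp only: chi_mult)
    have "(\<Sum>t\<in>residue_system. chi s * chi t * (if [s\<^sup>2 = t\<^sup>2] (mod int p) then int p else 0))
        = (\<Sum>t\<in>residue_system. if t \<in> {s, int p - s} then chi s * chi t * int p else 0)"
      by (intro sum.cong) (auto simp: iff)
    also have "\<dots> = (\<Sum>t\<in>{s, int p - s}. chi s * chi t * int p)"
      using s False by (subst sum.inter_restrict[symmetric]) (auto intro!: sum.cong)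
    also have "\<dots> = 2 * int p" using ne cs chi_nonzero_sq[OF nds] by simp
    finally show ?thesis using False by simp
  qed
  have "(\<Sum>c\<in>residue_system. (jacobsthal c)\<^sup>2)
      = (\<Sum>c\<in>residue_system. \<Sum>s\<in>residue_system. \<Sum>t\<in>residue_system. chi s * chi t * (chi (s\<^sup>2 + c) * chi (t\<^sup>2 + c)))"
    unfolding jacobsthal_def power2_eq_square sum_product by (simp only: mult_ac)
  also have "\<dots> = (\<Sum>s\<in>residue_system. \<Sum>t\<in>residue_system. chi s * chi t * (\<Sum>c\<in>residue_system. chi (s\<^sup>2 + c) * chi (t\<^sup>2 + c)))"
    unfolding sum_distrib_left
    by (rule trans[OF sum.swap], rule sum.cong[OF refl], rule sum.swap)
  also have "\<dots> = (\<Sum>s\<in>residue_system. (\<Sum>t\<in>residue_system. chi s * chi t * (if [s\<^sup>2 = t\<^sup>2] (mod int p) then int p else 0)))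
       - (\<Sum>s\<in>residue_system. chi s * (\<Sum>t\<in>residue_system. chi t))"
    by (simp add: inner right_diff_distrib sum_subtractf sum_distrib_left)
  also have "\<dots> = (\<Sum>s\<in>residue_system. if s = 0 then 0 else 2 * int p)"
    using diag sum_chi by simp
  also have "\<dots> = (\<Sum>s\<in>residue_system. 2 * int p - (if s = 0 then 2 * int p else 0))"
    by (intro sum.cong) auto
  also have "\<dots> = 2 * int p * (int p - 1)"
    using gt_2 by (simp add: sum_subtractf algebra_simps)
  finally show ?thesis .
qed

text \<open>The square of the sum at \<open>c\<close> depends only on the symbol of
  \<open>c\<close>, so the second moment determines the two values attained at residues and at
  nonresidues.\<close>

lemma jacobsthal_two_squares:
  assumes "chi (-1) = 1" "chi g = -1"
  shows "(jacobsthal 1)\<^sup>2 + (jacobsthal g)\<^sup>2 = 4 * int p"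
proof -
  \<comment> \<open>The two coefficients are twice the indicators of residues and of
    nonresidues.\<close>
  have "2 * (jacobsthal c)\<^sup>2 = (chi c * chi c + chi c) * (jacobsthal 1)\<^sup>2 + (chi c * chi c - chi c) * (jacobsthal g)\<^sup>2" for c
  proof -
    have one: "chi 1 = 1" using chi_nonzero_sq[of 1] chi_mult[of 1 1] prime_int not_prime_unit by fastforce
    consider "chi c = 0" | "chi c = 1" | "chi c = -1" using chi_cases by blast
    then show ?thesis
    proof cases
      case 1
      then have "jacobsthal c = jacobsthal 0"
        by (intro jacobsthal_cong) (simp add: chi_eq_0_iff cong_0_iff)
      then show ?thesis using 1 jacobsthal_0 by simp
    next
      case 2
      then show ?thesis using jacobsthal_sq_residue[of c 1] one by simp
    next
      case 3
      then show ?thesis using jacobsthal_sq_residue[of c g] assms by simp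
    qed
  qed
  then have "2 * (\<Sum>c\<in>residue_system. (jacobsthal c)\<^sup>2)
     = (\<Sum>c\<in>residue_system. (chi c * chi c + chi c) * (jacobsthal 1)\<^sup>2 + (chi c * chi c - chi c) * (jacobsthal g)\<^sup>2)"
    by (simp add: sum_distrib_left)
  also have "\<dots> = (\<Sum>c\<in>residue_system. chi c * chi c + chi c) * (jacobsthal 1)\<^sup>2 + (\<Sum>c\<in>residue_system. chi c * chi c - chi c) * (jacobsthal g)\<^sup>2"
    by (subst sum.distrib) (simp only: sum_distrib_right)
  also have "\<dots> = (int p - 1) * ((jacobsthal 1)\<^sup>2 + (jacobsthal g)\<^sup>2)"
    by (simp only: sum.distrib sum_subtractf sum_chi sum_chi_sq) (simp add: algebra_simps)
  finally have "(int p - 1) * ((jacobsthal 1)\<^sup>2 + (jacobsthal g)\<^sup>2) = (int p - 1) * (4 * int p)"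
    using sum_jacobsthal_sq[OF assms(1)] by (simp add: algebra_simps)
  then show ?thesis using gt_2 by simp
qed

text \<open>Pairing t with p - t gives the factor 2. The half sum has (p - 1)/2 summands, an even
  number, and each is odd: t^2 + g never vanishes modulo p because -g is a nonresidue.\<close>

lemma jacobsthal_nonresidue_half_even:
  assumes "chi (-1) = 1" "chi g = -1" "p mod 4 = 1"
  obtains b where "even b" "jacobsthal g = 2 * b"
proof -
  define n where "n = int ((p - 1) div 2)"
  define f where "f t = chi t * chi (t\<^sup>2 + g)" for t
  have "4 dvd p - 1" using assms(3) by (metis mod_eq_dvd_iff_nat prime prime_ge_1_nat mod_if one_less_numeral_iff semiring_norm(76))
  then have n: "int p = 2 * n + 1" "even n" "n \<ge> 0"
    using gt_2 unfolding n_def by (auto elim!: dvdE)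
  have sym: "f (int p - t) = f t" for t
  proof -
    have "chi (int p - t) = chi ((-1) * t)" by (intro chi_cong) (simp add: cong_iff_dvd_diff)
    moreover have "chi ((int p - t)\<^sup>2 + g) = chi (t\<^sup>2 + g)"
    proof (intro chi_cong)
      have "(int p - t)\<^sup>2 + g - (t\<^sup>2 + g) = int p * (int p - 2 * t)" by (simp add: power2_eq_square algebra_simps)
      then show "[(int p - t)\<^sup>2 + g = t\<^sup>2 + g] (mod int p)" by (metis cong_iff_dvd_diff dvd_triv_left)
    qed
    ultimately show ?thesis using assms(1) unfolding f_def by (simp only: chi_mult)
  qed
  have "residue_system = insert 0 ({1..n} \<union> {n + 1..2 * n})" using n by auto
  then have "jacobsthal g = f 0 + (\<Sum>t\<in>{1..n}. f t) + (\<Sum>t\<in>{n + 1..2 * n}. f t)"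
    unfolding jacobsthal_def f_def[symmetric] by (simp add: sum.union_disjoint)
  also have "(\<Sum>t\<in>{n + 1..2 * n}. f t) = (\<Sum>t\<in>{1..n}. f t)"
    by (rule sum.reindex_bij_witness[of _ "\<lambda>t. int p - t" "\<lambda>t. int p - t"]) (use n sym in auto)
  also have "f 0 = 0" using chi_eq_0_iff[of 0] by (simp add: f_def)
  finally have J: "jacobsthal g = 2 * (\<Sum>t\<in>{1..n}. f t)" by simp
  have "[(\<Sum>t\<in>{1..n}. f t) = (\<Sum>t\<in>{1..n}. 1)] (mod 2)"
  proof (intro cong_sum)
    fix t assume t: "t \<in> {1..n}"
    have nt: "\<not> int p dvd t" using t n by (auto dest: zdvd_imp_le)
    have "\<not> int p dvd t\<^sup>2 + g"
    proof
      assume "int p dvd t\<^sup>2 + g"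
      then have "chi (t\<^sup>2) = chi ((-1) * g)" by (intro chi_cong) (simp add: cong_iff_dvd_diff)
      then show False using chi_square[OF nt] assms by (simp only: chi_mult)
    qed
    then have "f t = 1 \<or> f t = -1"
      using nt chi_cases[of t] chi_cases[of "t\<^sup>2 + g"] chi_eq_0_iff[of t] chi_eq_0_iff[of "t\<^sup>2 + g"]
      by (auto simp: f_def)
    then show "[f t = 1] (mod 2)" by (auto simp: cong_def)
  qed
  then have "even (\<Sum>t\<in>{1..n}. f t)" using n by (simp add: cong_iff_dvd_diff)
  then show ?thesis using J that by blast
qed

text \<open>For one choice of the sign of \<open>y\<close>, p divides a x - b y. In (a x - b y)^2 +
  (a y + b x)^2 = p^2 the first square is then already p^2, being nonzero by parity, so the second
  is zero and the representations agree.\<close>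

lemma two_squares_unique:
  fixes a b x y :: int
  assumes "a\<^sup>2 + b\<^sup>2 = int p" "x\<^sup>2 + y\<^sup>2 = int p" "even b" "even y"
  shows "a\<^sup>2 = x\<^sup>2"
proof -
  have key: "a\<^sup>2 = x\<^sup>2" if xy: "x\<^sup>2 + y\<^sup>2 = int p" "even y" and dvd: "int p dvd a * x - b * y" for y
  proof -
    have "odd (int p)" using prime gt_2 by (simp add: prime_odd_nat)
    then have "odd a" "odd x" using assms(1,3) xy by (metis even_add even_power zero_less_numeral)+
    then have "odd (a * x - b * y)" using assms(3) by simp
    then have nz: "a * x - b * y \<noteq> 0" by presburger
    have id: "(a * x - b * y)\<^sup>2 + (a * y + b * x)\<^sup>2 = (int p)\<^sup>2"
    proof -
      have "(a * x - b * y)\<^sup>2 + (a * y + b * x)\<^sup>2 = (a\<^sup>2 + b\<^sup>2) * (x\<^sup>2 + y\<^sup>2)"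
        by (simp add: power2_eq_square algebra_simps)
      then show ?thesis using assms(1) xy(1) by (simp add: power2_eq_square)
    qed
    have "int p \<le> \<bar>a * x - b * y\<bar>" using nz dvd by (intro zdvd_imp_le) auto
    then have "(int p)\<^sup>2 \<le> (a * x - b * y)\<^sup>2" by (metis abs_of_nat power2_abs power_mono of_nat_0_le_iff)
    then have "(a * y + b * x)\<^sup>2 \<le> 0" using id by linarith
    then have "a * y + b * x = 0" by simp
    then have "a\<^sup>2 * y\<^sup>2 = b\<^sup>2 * x\<^sup>2" by Groebner_Basis.algebra
    then have "a\<^sup>2 * (int p - x\<^sup>2) = (int p - a\<^sup>2) * x\<^sup>2" using assms(1) xy(1) by (metis add_diff_cancel_left')
    then have "int p * a\<^sup>2 = int p * x\<^sup>2" by (simp add: algebra_simps)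
    then show ?thesis using gt_2 by simp
  qed
  \<comment> \<open>The two candidates for a multiple of p have a product divisible by p; both signs
    of \<open>y\<close> fall under \<open>key\<close>.\<close>
  have "(a * x - b * y) * (a * x - b * (- y)) = a\<^sup>2 * (x\<^sup>2 + y\<^sup>2) - (a\<^sup>2 + b\<^sup>2) * y\<^sup>2" by Groebner_Basis.algebra
  then have "(a * x - b * y) * (a * x - b * (- y)) = int p * (a\<^sup>2 - y\<^sup>2)"
    using assms by (simp add: algebra_simps)
  then have "int p dvd a * x - b * y \<or> int p dvd a * x - b * (- y)"
    using prime_int by (metis dvd_triv_left prime_dvd_mult_iff)
  then show ?thesis using key[of y] key[of "- y"] assms by auto
qed

lemma chi_minus_1: "p mod 4 = 1 \<Longrightarrow> chi (-1) = 1"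
proof (rule chi_unique)
  assume "p mod 4 = 1"
  then have "even ((p - 1) div 2)" by presburger
  then show "[chi (-1) = 1] (mod int p)" using chi_euler[of "-1"] by simp
qed (use chi_cases in auto)

text \<open>Dividing the two-square identity by 4 gives p = a^2 + b^2 with \<open>b\<close> even;
  parity decides which of the two squares is x^2.\<close>

lemma jacobsthal_1_sq:
  assumes "p mod 4 = 1" "int p = x\<^sup>2 + 4 * y\<^sup>2"
  shows "(jacobsthal 1)\<^sup>2 = 4 * x\<^sup>2"
proof -
  obtain g where g: "chi g = -1" using nonresidue_exists .
  have m1: "chi (-1) = 1" using chi_minus_1 assms(1) .
  obtain b where b: "even b" "jacobsthal g = 2 * b"
    using jacobsthal_nonresidue_half_even[OF m1 g assms(1)] .
  have sq: "(jacobsthal 1)\<^sup>2 + 4 * b\<^sup>2 = 4 * int p"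
    using jacobsthal_two_squares[OF m1 g] b by (simp add: power_mult_distrib)
  then have "(jacobsthal 1)\<^sup>2 = 2 * (2 * int p - 2 * b\<^sup>2)" by (simp add: algebra_simps)
  then have "even ((jacobsthal 1)\<^sup>2)" by simp
  then have "even (jacobsthal 1)" by simp
  then obtain a where a: "jacobsthal 1 = 2 * a" by (auto elim: evenE)
  then have "a\<^sup>2 + b\<^sup>2 = int p" using sq by (simp add: power_mult_distrib)
  moreover have "x\<^sup>2 + (2 * y)\<^sup>2 = int p" using assms by (simp add: power_mult_distrib)
  ultimately have "a\<^sup>2 = x\<^sup>2" using two_squares_unique[of a b x "2 * y"] b by simp
  then show ?thesis by (simp add: a power_mult_distrib)
qed

section \<open>Lifting the character sums to the modulus p^2\<close>

lemma power_p_cong: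
  fixes a b :: int
  assumes "[a = b] (mod int p)"
  shows "[a ^ p = b ^ p] (mod (int p)\<^sup>2)"
proof -
  have p: "Suc (p - 1) = p" using gt_2 by simp
  have "[(\<Sum>i<p. a ^ i * b ^ (p - 1 - i)) = (\<Sum>i<p. b ^ i * b ^ (p - 1 - i))] (mod int p)"
    using assms by (intro cong_sum cong_mult cong_pow cong_refl)
  also have "(\<Sum>i<p. b ^ i * b ^ (p - 1 - i)) = (\<Sum>i<p. b ^ (p - 1))"
    by (intro sum.cong) (auto simp: power_add[symmetric])
  also have "\<dots> = int p * b ^ (p - 1)" by simp
  also have "[int p * b ^ (p - 1) = 0] (mod int p)" by (simp add: cong_0_iff)
  \<comment> \<open>Both factors of a^p - b^p, namely a - b and this sum of p congruent terms, are
    multiples of p.\<close>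
  finally have "int p dvd (\<Sum>i<p. a ^ i * b ^ (p - 1 - i))" by (simp add: cong_0_iff)
  moreover have "int p dvd a - b" using assms by (simp add: cong_iff_dvd_diff)
  moreover have "a ^ p - b ^ p = (a - b) * (\<Sum>i<p. a ^ i * b ^ (p - 1 - i))"
    using diff_power_eq_sum[of a "p - 1" b] by (simp only: p)
  ultimately show ?thesis by (simp add: cong_iff_dvd_diff power2_eq_square mult_dvd_mono)
qed

lemma chi_power_lift: "[chi a = a ^ (p * ((p - 1) div 2))] (mod (int p)\<^sup>2)"
proof -
  have "odd p" using prime gt_2 by (simp add: prime_odd_nat)
  then have "chi a ^ p = chi a" using chi_cases[of a] gt_2 by auto
  then show ?thesis using power_p_cong[OF chi_euler[of a]] by (simp add: power_mult[symmetric] mult.commute)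
qed

text \<open>A Newton step for \<open>u\<^sup>2 = 1\<close> lifts the Euler criterion to the modulus \<open>p\<^sup>2\<close>
  with the small exponents \<open>(p - 1) / 2\<close> and \<open>3 (p - 1) / 2\<close>.\<close>

lemma chi_newton_lift:
  assumes "p > 3" "n = (p - 1) div 2"
  shows "[2 * chi a = 3 * a ^ n - a ^ (3 * n)] (mod (int p)\<^sup>2)"
proof (cases "int p dvd a")
  \<comment> \<open>Here p^2 must divide a^n already, which needs n at least 2 and thus
    \<open>p > 3\<close>.\<close>
  case True
  have "odd p" using prime gt_2 by (simp add: prime_odd_nat)
  then have "2 \<le> n" using assms by (auto elim!: oddE)
  then have "(int p)\<^sup>2 dvd a ^ n" using True by (meson dvd_power_le dvd_trans le_imp_power_dvd)
  moreover have "a ^ n dvd a ^ (3 * n)" by (simp add: le_imp_power_dvd)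
  ultimately have "(int p)\<^sup>2 dvd 3 * a ^ n - a ^ (3 * n)" by (meson dvd_diff dvd_mult dvd_trans)
  then show ?thesis using True chi_eq_0_iff[of a] by (metis cong_0_iff cong_sym mult_zero_right)
next
  case False
  define L u where "L = chi a" and "u = a ^ n"
  have "int p dvd u - L" using chi_euler[of a] cong_sym unfolding L_def u_def assms(2) cong_iff_dvd_diff by (metis cong_iff_dvd_diff)
  \<comment> \<open>With L^2 = 1 this product is u^3 - 3u + 2L, so its double zero at u = L gives
    the second factor p.\<close>
  then have "(int p)\<^sup>2 dvd (u - L)\<^sup>2 * (u + 2 * L)" by (simp add: power2_eq_square mult_dvd_mono)
  also have "(u - L)\<^sup>2 * (u + 2 * L) = 2 * L - (3 * u - u ^ 3)"
  proof -
    have "L * L = 1" using chi_nonzero_sq[OF False] by (simp add: L_def)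
    then show ?thesis by Groebner_Basis.algebra
  qed
  finally show ?thesis unfolding L_def u_def by (simp add: cong_iff_dvd_diff power_mult[symmetric] mult.commute)
qed

text \<open>A p-th power modulo p^2 depends only on the base modulo p. If p - 1 divides
  \<open>e\<close>, each power is congruent to the square of a symbol; otherwise scaling by a
  primitive root g multiplies the sum by g^(p e), and g^(p e) - 1 is prime to p.\<close>

lemma sum_power_residues:
  assumes "e > 0"
  shows "[(\<Sum>t\<in>residue_system. t ^ (p * e)) = (if (p - 1) dvd e then int p - 1 else 0)] (mod (int p)\<^sup>2)"
proof (cases "(p - 1) dvd e")
  case True
  then obtain j where j: "e = (p - 1) * j" by blast
  have "[(\<Sum>t\<in>residue_system. t ^ (p * e)) = (\<Sum>t\<in>residue_system. chi t * chi t)] (mod (int p)\<^sup>2)"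
  proof (intro cong_sum)
    fix t :: int
    have "even (p - 1)" using prime gt_2 by (simp add: prime_odd_nat)
    then have "t ^ (p * e) = (t ^ (p * ((p - 1) div 2))) ^ (2 * j)"
      unfolding power_mult[symmetric] j by (auto elim!: evenE simp: mult_ac)
    then have "[t ^ (p * e) = chi t ^ (2 * j)] (mod (int p)\<^sup>2)"
      using cong_pow[OF chi_power_lift, of t "2 * j"] cong_sym by metis
    moreover have "j > 0" using assms j by (cases j) auto
    then have "chi t ^ (2 * j) = chi t * chi t" using chi_cases[of t] by (auto simp: power_mult)
    ultimately show "[t ^ (p * e) = chi t * chi t] (mod (int p)\<^sup>2)" by simp
  qed
  then show ?thesis using True sum_chi_sq by simp
next
  case False
  \<comment> \<open>Reduction modulo p^2 turns the congruence of summands into the equality that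
    \<open>sum_residues_affine\<close> asks for.\<close>
  define F where "F t = t ^ (p * e) mod (int p)\<^sup>2" for t :: int
  define S where "S = (\<Sum>t\<in>residue_system. t ^ (p * e))"
  obtain g :: int where g: "\<And>e. [g ^ e = 1] (mod int p) \<longleftrightarrow> (p - 1) dvd e"
    using primitive_root_exists by blast
  have "[g ^ (p - 1) = 1] (mod int p)" using g by simp
  then have ng: "\<not> int p dvd g"
    by (metis cong_dvd_iff dvd_power gt_2 not_prime_unit prime_int zero_less_diff less_trans one_less_numeral_iff semiring_norm(76) dvd_trans)
  have "(\<Sum>t\<in>residue_system. F (g * t + 0)) = (\<Sum>t\<in>residue_system. F t)"
  proof (intro sum_residues_affine ng)
    fix s t assume "[s = t] (mod int p)"
    then have "[(s ^ p) ^ e = (t ^ p) ^ e] (mod (int p)\<^sup>2)" by (intro cong_pow power_p_cong)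
    then show "F s = F t" by (simp add: F_def cong_def power_mult)
  qed
  then have "[(\<Sum>t\<in>residue_system. (g * t) ^ (p * e)) = S] (mod (int p)\<^sup>2)"
    unfolding F_def S_def cong_def add_0_right by (metis mod_sum_eq)
  moreover have "(\<Sum>t\<in>residue_system. (g * t) ^ (p * e)) = g ^ (p * e) * S"
    by (simp only: S_def power_mult_distrib sum_distrib_left)
  ultimately have "(int p)\<^sup>2 dvd (g ^ (p * e) - 1) * S"
    by (simp add: cong_iff_dvd_diff left_diff_distrib)
  moreover have "coprime ((int p)\<^sup>2) (g ^ (p * e) - 1)"
  proof -
    \<comment> \<open>Since p is 1 modulo p - 1, \<open>p - 1\<close> divides \<open>p * e\<close>
      only if it divides \<open>e\<close>.\<close>
    have "p * e = (p - 1) * e + e" using gt_2 by (cases p) auto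
    then have "\<not> (p - 1) dvd p * e" using False by (simp add: dvd_add_right_iff)
    then have "\<not> int p dvd g ^ (p * e) - 1" using g by (simp add: cong_iff_dvd_diff[symmetric])
    then show ?thesis using prime_int by (simp add: prime_imp_coprime)
  qed
  ultimately show ?thesis using False by (simp add: S_def cong_0_iff coprime_dvd_mult_right_iff)
qed

lemma fermat_int: "[a ^ p = a] (mod int p)"
proof -
  have "odd p" using prime gt_2 by (simp add: prime_odd_nat)
  then have "p = (p - 1) div 2 * 2 + 1" by (auto elim!: oddE)
  then have "a ^ p = (a ^ ((p - 1) div 2))\<^sup>2 * a" by (metis power_add power_mult power_one_right)
  moreover have "[(a ^ ((p - 1) div 2))\<^sup>2 * a = (chi a)\<^sup>2 * a] (mod int p)"
    using chi_euler[of a] by (intro cong_mult cong_pow cong_refl) (rule cong_sym)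
  moreover have "[(chi a)\<^sup>2 * a = a] (mod int p)"
    using chi_nonzero_sq[of a] by (cases "int p dvd a") (auto simp: power2_eq_square cong_iff_dvd_diff)
  ultimately show ?thesis by (metis cong_trans)
qed

text \<open>Binomial expansion leaves the power sums with exponents p (n + 2k), of which only those
  with p - 1 dividing n + 2k survive; \<open>n > 0\<close> keeps all exponents positive.\<close>

lemma sum_power_times_binomial:
  assumes "n > 0"
  shows "[(\<Sum>t\<in>residue_system. t ^ (p * n) * (t ^ (2 * p) + 1) ^ N)
    = (int p - 1) * (\<Sum>k\<in>{k. k \<le> N \<and> (p - 1) dvd n + 2 * k}. int (N choose k))] (mod (int p)\<^sup>2)"
proof -
  have "(\<Sum>t\<in>residue_system. t ^ (p * n) * (t ^ (2 * p) + 1) ^ N)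
      = (\<Sum>t\<in>residue_system. \<Sum>k\<le>N. int (N choose k) * t ^ (p * (n + 2 * k)))"
  proof (intro sum.cong refl)
    fix t :: int
    show "t ^ (p * n) * (t ^ (2 * p) + 1) ^ N = (\<Sum>k\<le>N. int (N choose k) * t ^ (p * (n + 2 * k)))"
      unfolding binomial_ring sum_distrib_left
      by (intro sum.cong refl) (simp add: power_mult[symmetric] power_add[symmetric] distrib_left mult_ac)
  qed
  also have "\<dots> = (\<Sum>k\<le>N. int (N choose k) * (\<Sum>t\<in>residue_system. t ^ (p * (n + 2 * k))))"
    by (subst sum.swap) (simp add: sum_distrib_left)
  also have "[\<dots> = (\<Sum>k\<le>N. int (N choose k) * (if (p - 1) dvd n + 2 * k then int p - 1 else 0))] (mod (int p)\<^sup>2)"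
    using assms by (intro cong_sum cong_mult cong_refl sum_power_residues) simp
  also have "(\<Sum>k\<le>N. int (N choose k) * (if (p - 1) dvd n + 2 * k then int p - 1 else 0))
     = (\<Sum>k\<in>{k \<in> {..N}. (p - 1) dvd n + 2 * k}. (int p - 1) * int (N choose k))"
    by (subst sum.inter_filter) (auto intro!: sum.cong)
  also have "\<dots> = (int p - 1) * (\<Sum>k\<in>{k. k \<le> N \<and> (p - 1) dvd n + 2 * k}. int (N choose k))"
    by (simp add: sum_distrib_left)
  finally show ?thesis .
qed

text \<open>The first symbol is replaced by t^(2 m p) and the second one by its Newton lift; the
  surviving binomial coefficients have lower index m for the power 2m, and m, 3m, 5m for the power
  6m.\<close>

lemma jacobsthal_1_binomial:
  assumes p: "p = 4 * m + 1"
  shows "[2 * jacobsthal 1 = (int p - 1) * (3 * int ((2 * m) choose m)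
      - 2 * int ((6 * m) choose m) - int ((6 * m) choose (3 * m)))] (mod (int p)\<^sup>2)"
proof -
  have m: "m > 0" using p gt_2 by (cases m) auto
  have n: "2 * m = (p - 1) div 2" using p by simp
  \<comment> \<open>By Fermat t^(2p) may replace t^2 inside the symbol; all exponents of t become
    multiples of p, as the power sums modulo p^2 require.\<close>
  define f where "f t = t ^ (2 * p) + 1" for t :: int
  have "2 * jacobsthal 1 = (\<Sum>t\<in>residue_system. chi t * (2 * chi (f t)))"
  proof -
    have "chi (t\<^sup>2 + 1) = chi (f t)" for t
    proof (rule chi_cong)
      show "[t\<^sup>2 + 1 = f t] (mod int p)"
        using cong_pow[OF fermat_int, of t 2] cong_sym
        by (auto simp: f_def power_mult[symmetric] mult.commute intro!: cong_add)
    qed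
    then show ?thesis unfolding jacobsthal_def by (simp add: sum_distrib_left mult_ac)
  qed
  also have "[\<dots> = (\<Sum>t\<in>residue_system. t ^ (p * (2 * m)) * (3 * f t ^ (2 * m) - f t ^ (3 * (2 * m))))] (mod (int p)\<^sup>2)"
    using chi_power_lift chi_newton_lift[OF _ n] m p unfolding n[symmetric]
    by (intro cong_sum cong_mult) auto
  also have "(\<Sum>t\<in>residue_system. t ^ (p * (2 * m)) * (3 * f t ^ (2 * m) - f t ^ (3 * (2 * m))))
     = 3 * (\<Sum>t\<in>residue_system. t ^ (p * (2 * m)) * f t ^ (2 * m)) - (\<Sum>t\<in>residue_system. t ^ (p * (2 * m)) * f t ^ (6 * m))"
    by (simp add: sum_distrib_left sum_subtractf right_diff_distrib mult_ac)
  also have "[\<dots> = 3 * ((int p - 1) * int ((2 * m) choose m))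
     - (int p - 1) * (int ((6 * m) choose m) + int ((6 * m) choose (3 * m)) + int ((6 * m) choose (5 * m)))] (mod (int p)\<^sup>2)"
  proof -
    have iff: "(p - 1) dvd 2 * m + 2 * k \<longleftrightarrow> k = m \<or> k = 3 * m \<or> k = 5 * m" if "k \<le> 6 * m" for k
    proof
      assume "(p - 1) dvd 2 * m + 2 * k"
      then have "4 * m dvd 2 * m + 2 * k" using p by simp
      then obtain q where "2 * m + 2 * k = 4 * m * q" by (rule dvdE)
      then have q: "m + k = 2 * m * q" by linarith
      have "q \<noteq> 0" using q m by (intro notI) simp
      moreover have "q < 4"
      proof (rule ccontr)
        assume "\<not> q < 4"
        then have "2 * m * 4 \<le> 2 * m * q" by (intro mult_le_mono2) simp
        then show False using q that m by linarith
      qed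
      ultimately have "q = 1 \<or> q = 2 \<or> q = 3" by linarith
      then show "k = m \<or> k = 3 * m \<or> k = 5 * m" using q by auto
    next
      have "4 * m dvd 4 * m" "4 * m dvd 8 * m" "4 * m dvd 12 * m"
        by (auto intro: dvdI[of _ _ 2] dvdI[of _ _ 3])
      then show "k = m \<or> k = 3 * m \<or> k = 5 * m \<Longrightarrow> (p - 1) dvd 2 * m + 2 * k" using p by auto
    qed
    have "{k. k \<le> 2 * m \<and> (p - 1) dvd 2 * m + 2 * k} = {m}"
      using iff m p by auto
    then have 1: "[(\<Sum>t\<in>residue_system. t ^ (p * (2 * m)) * f t ^ (2 * m)) = (int p - 1) * int ((2 * m) choose m)] (mod (int p)\<^sup>2)"
      using sum_power_times_binomial[of "2 * m" "2 * m"] m by (simp add: f_def)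
    have "{k. k \<le> 6 * m \<and> (p - 1) dvd 2 * m + 2 * k} = {m, 3 * m, 5 * m}"
      using iff m p by auto
    then have 2: "[(\<Sum>t\<in>residue_system. t ^ (p * (2 * m)) * f t ^ (6 * m))
       = (int p - 1) * (int ((6 * m) choose m) + int ((6 * m) choose (3 * m)) + int ((6 * m) choose (5 * m)))] (mod (int p)\<^sup>2)"
      using sum_power_times_binomial[of "2 * m" "6 * m"] m by (simp add: f_def add.assoc)
    show ?thesis by (intro cong_diff cong_mult cong_refl 1 2)
  qed
  also have "(6 * m) choose (5 * m) = (6 * m) choose m"
    using binomial_symmetric[of m "6 * m"] by simp
  finally show ?thesis by (simp add: algebra_simps)
qed

end

section \<open>Congruences modulo the square of a prime\<close>

context odd_prime
begin

text \<open>The localisation of the integers at p, phrased with the reduced denominator to match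
  \<open>rat_cong_pow\<close>.\<close>

definition p_integral :: "rat set" where
  "p_integral = {c. coprime (snd (quotient_of c)) (int p)}"

text \<open>Any fraction with denominator prime to p will do, since the reduced denominator divides
  every other one.\<close>

lemma p_integral_iff: "c \<in> p_integral \<longleftrightarrow> (\<exists>a b. \<not> int p dvd b \<and> c = of_int a / of_int b)"
proof
  assume c: "c \<in> p_integral"
  obtain a b where ab: "quotient_of c = (a, b)" by fastforce
  then have "c = of_int a / of_int b" by (rule quotient_of_div)
  moreover have "\<not> int p dvd b"
    using c ab prime_int by (metis p_integral_def mem_Collect_eq snd_conv coprime_common_divisor dvd_refl not_prime_unit)
  ultimately show "\<exists>a b. \<not> int p dvd b \<and> c = of_int a / of_int b" by blast
next
  assume "\<exists>a b. \<not> int p dvd b \<and> c = of_int a / of_int b"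
  then obtain a b where ab: "\<not> int p dvd b" "c = of_int a / of_int b" by blast
  obtain a' b' where q: "quotient_of c = (a', b')" by fastforce
  have c': "c = of_int a' / of_int b'" and cop: "coprime a' b'" and pos: "b' > 0"
    using q by (simp_all add: quotient_of_div quotient_of_coprime quotient_of_denom_pos)
  have "b \<noteq> 0" using ab by auto
  then have "of_int (a' * b) = (of_int (a * b') :: rat)"
    using ab(2) c' pos by (simp add: field_simps)
  then have "a' * b = a * b'" by linarith
  then have "b' dvd b" using cop by (metis coprime_commute coprime_dvd_mult_right_iff dvd_triv_right)
  then have "\<not> int p dvd b'" using ab dvd_trans by blast
  then have "coprime b' (int p)" using prime_int by (metis coprime_commute prime_imp_coprime)
  then show "c \<in> p_integral" by (simp add: p_integral_def q)
qed

lemma of_int_p_integral [simp]: "of_int a \<in> p_integral"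
  unfolding p_integral_iff using prime_int not_prime_unit by (intro exI[of _ a] exI[of _ 1]) auto

lemma of_nat_p_integral [simp]: "of_nat a \<in> p_integral"
  using of_int_p_integral[of "int a"] by simp

lemma numeral_p_integral [simp]: "numeral a \<in> p_integral" "0 \<in> p_integral" "1 \<in> p_integral"
  using of_int_p_integral[of "numeral a"] of_int_p_integral[of 0] of_int_p_integral[of 1] by simp_all

lemma p_integral_mult [simp]: "x \<in> p_integral \<Longrightarrow> y \<in> p_integral \<Longrightarrow> x * y \<in> p_integral"
proof -
  assume "x \<in> p_integral" "y \<in> p_integral"
  then obtain a b c d where "\<not> int p dvd b" "x = of_int a / of_int b" "\<not> int p dvd d" "y = of_int c / of_int d"
    unfolding p_integral_iff by blast
  then have "\<not> int p dvd b * d" "x * y = of_int (a * c) / of_int (b * d)"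
    using prime_int by (simp_all add: prime_dvd_mult_iff)
  then show ?thesis unfolding p_integral_iff by blast
qed

lemma p_integral_add [simp]: "x \<in> p_integral \<Longrightarrow> y \<in> p_integral \<Longrightarrow> x + y \<in> p_integral"
proof -
  assume "x \<in> p_integral" "y \<in> p_integral"
  then obtain a b c d where *: "\<not> int p dvd b" "x = of_int a / of_int b" "\<not> int p dvd d" "y = of_int c / of_int d"
    unfolding p_integral_iff by blast
  then have "b \<noteq> 0" "d \<noteq> 0" by auto
  then have "\<not> int p dvd b * d" "x + y = of_int (a * d + c * b) / of_int (b * d)"
    using prime_int * by (simp_all add: prime_dvd_mult_iff field_simps)
  then show ?thesis unfolding p_integral_iff by blast
qed

lemma p_integral_uminus [simp]: "x \<in> p_integral \<Longrightarrow> - x \<in> p_integral"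
  using p_integral_mult[of "of_int (-1)" x] of_int_p_integral[of "-1"] by simp

lemma p_integral_diff [simp]: "x \<in> p_integral \<Longrightarrow> y \<in> p_integral \<Longrightarrow> x - y \<in> p_integral"
  using p_integral_add[of x "- y"] by simp

lemma p_integral_power [simp]: "x \<in> p_integral \<Longrightarrow> x ^ k \<in> p_integral"
  by (induction k) simp_all

lemma p_integral_sum: "(\<And>i. i \<in> A \<Longrightarrow> f i \<in> p_integral) \<Longrightarrow> sum f A \<in> p_integral"
  by (induction A rule: infinite_finite_induct) simp_all

text \<open>Integrality of the inverse is what division and cancellation use; \<open>u\<close>
  itself may have p in its denominator.\<close>

definition p_unit :: "rat \<Rightarrow> bool" where
  "p_unit u \<longleftrightarrow> u \<noteq> 0 \<and> 1 / u \<in> p_integral"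

lemma p_integral_divide: "x \<in> p_integral \<Longrightarrow> p_unit u \<Longrightarrow> x / u \<in> p_integral"
  using p_integral_mult[of x "1 / u"] by (simp add: p_unit_def)

lemma p_unit_of_int: "\<not> int p dvd a \<Longrightarrow> p_unit (of_int a)"
  unfolding p_unit_def p_integral_iff by (auto intro: exI[of _ 1] exI[of _ a])

lemma p_unit_of_nat: "\<not> p dvd a \<Longrightarrow> p_unit (of_nat a)"
  using p_unit_of_int[of "int a"] by simp

lemma p_unit_mult: "p_unit u \<Longrightarrow> p_unit v \<Longrightarrow> p_unit (u * v)"
  using p_integral_mult[of "1 / u" "1 / v"] by (simp add: p_unit_def)

lemma p_unit_power: "p_unit u \<Longrightarrow> p_unit (u ^ k)"
  by (induction k) (simp_all add: p_unit_mult, simp add: p_unit_def)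

section \<open>Calculus of congruences modulo p^2\<close>

abbreviation p2_cong :: "rat \<Rightarrow> rat \<Rightarrow> bool" (infix "\<doteq>" 50) where
  "a \<doteq> b \<equiv> rat_cong_pow p 2 a b"

lemma p2_cong_iff: "a \<doteq> b \<longleftrightarrow> (\<exists>c\<in>p_integral. a - b = of_nat p ^ 2 * c)"
  unfolding rat_cong_pow_def p_integral_def by auto

lemma p2_congI: "a - b = of_nat p ^ 2 * c \<Longrightarrow> c \<in> p_integral \<Longrightarrow> a \<doteq> b"
  unfolding p2_cong_iff by blast

lemma p2_cong_refl [simp]: "a \<doteq> a"
  by (rule p2_congI[of _ _ 0]) simp_all

lemma p2_cong_sym: "a \<doteq> b \<Longrightarrow> b \<doteq> a"
  unfolding p2_cong_iff by (metis minus_diff_eq mult_minus_right p_integral_uminus)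

lemma p2_cong_add: "a \<doteq> b \<Longrightarrow> c \<doteq> d \<Longrightarrow> a + c \<doteq> b + d"
  unfolding p2_cong_iff by (metis add_diff_add distrib_left p_integral_add)

lemma p2_cong_trans [trans]: "a \<doteq> b \<Longrightarrow> b \<doteq> c \<Longrightarrow> a \<doteq> c"
  unfolding p2_cong_iff by (metis diff_add_cancel add_diff_eq distrib_left p_integral_add)

lemma p2_cong_mult_left: "a \<doteq> b \<Longrightarrow> c \<in> p_integral \<Longrightarrow> c * a \<doteq> c * b"
  unfolding p2_cong_iff by (metis mult.left_commute p_integral_mult right_diff_distrib)

lemma p2_cong_mult: "a \<doteq> b \<Longrightarrow> c \<doteq> d \<Longrightarrow> b \<in> p_integral \<Longrightarrow> c \<in> p_integral \<Longrightarrow> a * c \<doteq> b * d"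
  using p2_cong_trans[of "c * a" "c * b" "b * d"] p2_cong_mult_left[of a b c] p2_cong_mult_left[of c d b]
  by (simp add: mult.commute)

lemma p2_cong_uminus: "a \<doteq> b \<Longrightarrow> - a \<doteq> - b"
  using p2_cong_mult_left[of a b "-1"] by simp

lemma p2_cong_diff: "a \<doteq> b \<Longrightarrow> c \<doteq> d \<Longrightarrow> a - c \<doteq> b - d"
  using p2_cong_add[OF _ p2_cong_uminus] by fastforce

lemma p2_cong_sum: "(\<And>i. i \<in> A \<Longrightarrow> f i \<doteq> g i) \<Longrightarrow> sum f A \<doteq> sum g A"
  by (induction A rule: infinite_finite_induct) (simp_all add: p2_cong_add)

lemma p2_cong_cancel: "u * a \<doteq> u * b \<Longrightarrow> p_unit u \<Longrightarrow> a \<doteq> b"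
  using p2_cong_mult_left[of "u * a" "u * b" "1 / u"] by (simp add: p_unit_def)

lemma p2_cong_integral: "a \<doteq> b \<Longrightarrow> b \<in> p_integral \<Longrightarrow> a \<in> p_integral"
  unfolding p2_cong_iff
  by (metis add.commute diff_add_cancel of_nat_p_integral p_integral_add p_integral_mult p_integral_power)

lemma p2_cong_of_int: "[a = b] (mod (int p)\<^sup>2) \<Longrightarrow> of_int a \<doteq> of_int b"
proof -
  assume "[a = b] (mod (int p)\<^sup>2)"
  then obtain c where "a - b = (int p)\<^sup>2 * c" by (auto simp: cong_iff_dvd_diff)
  then have "of_int a - of_int b = of_nat p ^ 2 * (of_int c :: rat)"
    by (metis of_int_diff of_int_mult of_int_of_nat_eq of_int_power)
  then show ?thesis by (rule p2_congI) simp
qed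

text \<open>Terms of degree two or more in \<open>of_nat p * y\<close> vanish modulo p^2, so the
  product is affine in \<open>y\<close>; the slope \<open>e\<close> is the same for all
  \<open>y\<close>.\<close>

lemma prod_shift_linear:
  assumes "finite I"
  shows "\<exists>e\<in>p_integral. \<forall>y\<in>p_integral.
    (\<Prod>i\<in>I. of_nat p * y + of_nat i) \<doteq> of_nat (\<Prod>I) + of_nat p * y * e"
  using assms
proof (induction I rule: finite_induct)
  case empty
  show ?case by (intro bexI[of _ 0]) simp_all
next
  case (insert j I)
  then obtain e where e: "e \<in> p_integral"
    "\<And>y. y \<in> p_integral \<Longrightarrow> (\<Prod>i\<in>I. of_nat p * y + of_nat i) \<doteq> of_nat (\<Prod>I) + of_nat p * y * e"
    by blast
  show ?case
  proof (intro bexI ballI)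
    fix y assume y: "y \<in> p_integral"
    have "(\<Prod>i\<in>insert j I. of_nat p * y + of_nat i) \<doteq> (of_nat p * y + of_nat j) * (of_nat (\<Prod>I) + of_nat p * y * e)"
      using insert.hyps e y by (simp add: p2_cong_mult_left)
    also have "\<dots> \<doteq> of_nat (\<Prod>(insert j I)) + of_nat p * y * (of_nat (\<Prod>I) + of_nat j * e)"
      using insert.hyps e y
      by (intro p2_congI[of _ _ "y * y * e"]) (simp_all add: algebra_simps power2_eq_square)
    finally show "(\<Prod>i\<in>insert j I. of_nat p * y + of_nat i)
      \<doteq> of_nat (\<Prod>(insert j I)) + of_nat p * y * (of_nat (\<Prod>I) + of_nat j * e)" .
  qed (use e in \<open>simp del: of_nat_prod\<close>)
qed

end

section \<open>The cubic sum\<close>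

definition cubic_term :: "nat \<Rightarrow> rat" where
  "cubic_term k = of_nat ((2 * k) choose k) ^ 3 / (-8) ^ k"

lemma cubic_term_Suc:
  "cubic_term (Suc k) = - ((2 * of_nat k + 1) ^ 3 / (of_nat k + 1) ^ 3) * cubic_term k"
proof -
  have "cubic_term (Suc k) = of_nat ((2 * (k + 1)) choose (k + 1)) ^ 3 / (-8) ^ Suc k"
    by (simp only: cubic_term_def Suc_eq_plus1)
  also have "\<dots> = - ((2 * of_nat k + 1) ^ 3 / (of_nat k + 1) ^ 3) * cubic_term k"
    unfolding central_binomial_Suc cubic_term_def power_mult_distrib power_divide by simp
  finally show ?thesis .
qed

text \<open>A decomposition of 27/(K+2) into 13 - 9K, K^2/(K+1) and (2K+1)^3/((K+1)(K+2)): by the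
  term ratio the last two become \<open>h k\<close> and \<open>- h (Suc k)\<close>.\<close>

lemma cubic_term_telescope:
  defines "h \<equiv> \<lambda>k. of_nat k ^ 2 * cubic_term k / (of_nat k + 1)"
  shows "27 * (cubic_term k / (of_nat k + 2)) = 13 * cubic_term k - 9 * (of_nat k * cubic_term k) + h k - h (Suc k)"
proof -
  define K :: rat where "K = of_nat k"
  have "K \<ge> 0" by (simp add: K_def)
  then have nz: "K + 1 \<noteq> 0" "K + 2 \<noteq> 0" by linarith+
  have h': "h (Suc k) = - ((2*K+1)^3 / ((K+1) * (K+2))) * cubic_term k"
    unfolding h_def cubic_term_Suc K_def[symmetric] of_nat_Suc
    using nz by (simp add: power2_eq_square power3_eq_cube divide_simps) (simp add: algebra_simps)
  have "27 / (K+2) = 13 - 9*K + K^2 / (K+1) + (2*K+1)^3 / ((K+1) * (K+2))"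
    using nz by (simp add: power2_eq_square power3_eq_cube divide_simps) (simp add: algebra_simps)
  from arg_cong[OF this, of "\<lambda>x. x * cubic_term k"] show ?thesis
    unfolding h' unfolding h_def K_def[symmetric] by (simp add: algebra_simps)
qed

text \<open>Rewrite 13 - 9k as 16 - 3(3k + 1) and telescope. The boundary term carries (2n + 1)^3,
  which is p^3 in the application.\<close>

lemma sum_cubic_term_divide:
  "27 * (\<Sum>k\<le>n. cubic_term k / (of_nat k + 2))
     = 16 * (\<Sum>k\<le>n. cubic_term k) - 3 * (\<Sum>k\<le>n. (3 * of_nat k + 1) * cubic_term k)
       + (2 * of_nat n + 1) ^ 3 * (cubic_term n / ((of_nat n + 1) * (of_nat n + 2)))"
proof -
  define h where "h k = of_nat k ^ 2 * cubic_term k / (of_nat k + 1)" for k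
  have nz: "(of_nat n + 1 :: rat) \<noteq> 0" "(of_nat n + 2 :: rat) \<noteq> 0"
    using of_nat_0_le_iff[of n, where ?'a = rat] by linarith+
  have step: "27 * (cubic_term k / (of_nat k + 2))
      = 16 * cubic_term k - 3 * ((3 * of_nat k + 1) * cubic_term k) + (h k - h (Suc k))" for k
    using cubic_term_telescope[of k] unfolding h_def[symmetric]
    by (simp add: algebra_simps)
  have "27 * (\<Sum>k\<le>n. cubic_term k / (of_nat k + 2))
      = (\<Sum>k\<le>n. 16 * cubic_term k - 3 * ((3 * of_nat k + 1) * cubic_term k) + (h k - h (Suc k)))"
    unfolding sum_distrib_left
    by (intro sum.cong refl step)
  also have "\<dots> = 16 * (\<Sum>k\<le>n. cubic_term k) - 3 * (\<Sum>k\<le>n. (3 * of_nat k + 1) * cubic_term k)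
      + (h 0 - h (Suc n))"
    unfolding sum.distrib sum_subtractf sum_distrib_left[symmetric]
    using sum_telescope[of h n] by (simp add: sum_subtractf)
  also have "h 0 - h (Suc n) = (2 * of_nat n + 1) ^ 3 * (cubic_term n / ((of_nat n + 1) * (of_nat n + 2)))"
    unfolding h_def cubic_term_Suc of_nat_Suc
    using nz by (simp add: power2_eq_square power3_eq_cube divide_simps) (simp add: algebra_simps)
  finally show ?thesis .
qed

section \<open>Comparison of the cubic terms with the hypergeometric terms\<close>

lemma wz_term_0: "of_nat (2 * n + 1) * wz_term n 0 = 1"
  unfolding wz_term_def by (simp add: fact_reduce[of "2 * n + 1"])

text \<open>The ratio involves \<open>q\<close> only through q^2, and at q = 0 it becomes the ratio
  of consecutive cubic terms; hence the agreement modulo p^2 when q = p.\<close>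

lemma wz_term_Suc:
  assumes "k < n"
  defines "q \<equiv> of_nat (2 * n + 1)"
  shows "wz_term n (Suc k) = - ((2 * of_nat k + 1) * (q^2 - (2 * of_nat k + 1)^2)
            / ((of_nat k + 1) * (q^2 - (of_nat k + 1)^2))) * wz_term n k"
proof -
  obtain d where n: "n = k + d + 1" using assms(1) by (metis add.right_neutral add_Suc_right less_natE Suc_eq_plus1)
  define K D :: rat where "K = of_nat k" and "D = of_nat d"
  have "K \<ge> 0" "D \<ge> 0" by (simp_all add: K_def D_def)
  then have nz: "K + 1 \<noteq> 0" "K + 2*D + 2 \<noteq> 0" "3*K + 2*D + 4 \<noteq> 0" "D + 1 \<noteq> 0" by linarith+
  have e: "n + k = 2 * k + d + 1" "2 * n - k = k + 2 * d + 2" "n - k = d + 1" "2 * n + 1 + k = 3 * k + 2 * d + 3"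
    using n by auto
  have e': "n + Suc k = 2 * k + d + 2" "2 * n - Suc k = k + 2 * d + 1" "n - Suc k = d" "2 * n + 1 + Suc k = 3 * k + 2 * d + 4"
    using n by auto
  have f1: "fact (2 * k + d + 2) = (2*K+D+2) * (fact (2 * k + d + 1) :: rat)"
    by (simp add: K_def D_def add_ac)
  have f2: "fact (k + 2 * d + 2) = (K+2*D+2) * (fact (k + 2 * d + 1) :: rat)"
    by (simp add: K_def D_def add_ac)
  have f3: "fact (d + 1) = (D+1) * (fact d :: rat)"
    by (simp add: K_def D_def add_ac)
  have f4: "fact (3 * k + 2 * d + 4) = (3*K+2*D+4) * (fact (3 * k + 2 * d + 3) :: rat)"
    by (simp add: K_def D_def add_ac numeral_eq_Suc)
  have q: "q^2 - (2*K+1)^2 = 4 * ((2*K+D+2) * (D+1))" "q^2 - (K+1)^2 = (K+2*D+2) * (3*K+2*D+4)"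
    unfolding q_def n K_def D_def by (simp_all add: power2_eq_square algebra_simps)
  have "-4 * s / c * w * (x * A) * B / (i * (y * G)) = - (s * (4 * (x * j)) / (c * (z * y))) * (w * A * (z * B) / (j * i * G))"
    if "z \<noteq> 0" "j \<noteq> 0" for s c w x A B i y G j z :: rat
    using that by (simp add: mult_ac)
  from this[OF nz(2,4)] show ?thesis
    unfolding K_def[symmetric] q unfolding wz_term_def e e' f1 f2 f3 f4 wz_coeff_Suc K_def[symmetric] .
qed

text \<open>Serves to evaluate a shifted product at -p/2, where all factors are halves of odd
  numbers.\<close>

lemma binomial_times_fact_odd: "of_nat ((2 * m) choose m) * fact m = (2 ^ m * (\<Prod>j<m. 2 * of_nat j + 1) :: rat)"
proof (induction m)
  case (Suc m)
  have "of_nat ((2 * Suc m) choose Suc m) * fact (Suc m)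
      = 2 * (2 * of_nat m + 1) * (of_nat ((2 * m) choose m) * fact m :: rat)"
    unfolding Suc_eq_plus1 central_binomial_Suc by (simp add: divide_simps)
  then show ?case unfolding Suc.IH by (simp add: mult_ac del: binomial_Suc_Suc)
qed simp

context odd_prime
begin

text \<open>Induction along the term ratios \<open>r\<close> and \<open>r'\<close>, whose
  denominators are prime to p because k + 1 is less than p.\<close>

lemma cubic_term_cong_wz_term:
  assumes p: "p = 2 * n + 1" and "k \<le> n"
  shows "cubic_term k \<in> p_integral \<and> of_nat p * wz_term n k \<doteq> cubic_term k"
  using assms(2)
proof (induction k)
  case 0
  then show ?case using wz_term_0[of n, folded p] by (simp add: cubic_term_def)
next
  case (Suc k)
  define K P :: rat where "K = of_nat k" and "P = of_nat p"
  have k: "k < n" using Suc by simp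
  then have "\<not> p dvd k + 1" using p by (auto dest: dvd_imp_le)
  then have u1: "p_unit (K + 1)" using p_unit_of_nat[of "k + 1"] by (simp add: K_def add.commute)
  have u2: "p_unit (P^2 - (K + 1)^2)"
  proof -
    have "\<not> int p dvd (int p)\<^sup>2 - (int (k + 1))\<^sup>2"
    proof
      assume "int p dvd (int p)\<^sup>2 - (int (k + 1))\<^sup>2"
      then have "int p dvd (int (k + 1))\<^sup>2" by (simp add: dvd_diff_right_iff power2_eq_square)
      then show False using \<open>\<not> p dvd k + 1\<close> prime_int prime_dvd_power int_dvd_int_iff by blast
    qed
    from p_unit_of_int[OF this] show ?thesis by (simp add: P_def K_def add.commute)
  qed
  have nz: "K + 1 \<noteq> 0" "P^2 - (K+1)^2 \<noteq> 0" using u1 u2 by (auto simp: p_unit_def)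
  define r r' where "r = - ((2*K+1) * (P^2 - (2*K+1)^2) / ((K+1) * (P^2 - (K+1)^2)))"
    and "r' = - ((2*K+1)^3 / (K+1)^3)"
  have KP: "K \<in> p_integral" "P \<in> p_integral" by (simp_all add: K_def P_def)
  have r': "r' \<in> p_integral" unfolding r'_def using u1 KP by (intro p_integral_uminus p_integral_divide p_unit_power) simp_all
  have IH: "cubic_term k \<in> p_integral" "P * wz_term n k \<doteq> cubic_term k" using Suc P_def by simp_all
  have "r \<doteq> r'"
  proof (rule p2_congI)
    show "(2*K+1) * ((2*K+1)^2 - (K+1)^2) / ((K+1)^3 * (P^2 - (K+1)^2)) \<in> p_integral"
      using u1 u2 KP by (intro p_integral_divide p_unit_mult p_unit_power) simp_all
    have "- (a * (P^2 - a^2) / (c * Q)) - - (a^3 / c^3) = P^2 * (a * (a^2 - c^2) / (c^3 * Q))"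
      if "c \<noteq> 0" "Q \<noteq> 0" "Q = P^2 - c^2" for a c Q
    proof -
      have "a * (P^2 - a^2) / (c * Q) = a * (P^2 - a^2) * c^2 / (c^3 * Q)"
        using that by (simp add: power2_eq_square power3_eq_cube)
      moreover have "a^3 / c^3 = a^3 * Q / (c^3 * Q)" using that by simp
      moreover have "- (a * (P^2 - a^2) * c^2) + a^3 * Q = P^2 * (a * (a^2 - c^2))"
        unfolding that(3) by Groebner_Basis.algebra
      ultimately show ?thesis by (metis (no_types) add_divide_distrib diff_minus_eq_add minus_divide_left times_divide_eq_right)
    qed
    from this[OF nz refl] show "r - r' = of_nat p ^ 2 * ((2*K+1) * ((2*K+1)^2 - (K+1)^2) / ((K+1)^3 * (P^2 - (K+1)^2)))"
      unfolding r_def r'_def P_def[symmetric] .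
  qed
  have "P * wz_term n (Suc k) = r * (P * wz_term n k)"
    using wz_term_Suc[OF k] unfolding p[symmetric] r_def K_def P_def by simp
  moreover have "r * (P * wz_term n k) \<doteq> r' * cubic_term k"
    using \<open>r \<doteq> r'\<close> IH r' p2_cong_integral by (intro p2_cong_mult) auto
  moreover have "cubic_term (Suc k) = r' * cubic_term k" unfolding cubic_term_Suc r'_def K_def by simp
  ultimately show ?case using r' IH(1) by (metis P_def p_integral_mult)
qed

lemma sum_cubic_term_divide_cong:
  assumes p: "p = 2 * n + 1" and "n \<ge> 2"
  shows "27 * (\<Sum>k\<le>n. cubic_term k / (of_nat k + 2))
     \<doteq> 16 * (of_nat p * (\<Sum>k\<le>n. wz_term n k)) - 3 * ((-1) ^ n * of_nat p)"
proof -
  note ct = cubic_term_cong_wz_term[OF p]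
  have T: "(\<Sum>k\<le>n. cubic_term k) \<doteq> of_nat p * (\<Sum>k\<le>n. wz_term n k)"
    unfolding sum_distrib_left using ct p2_cong_sym by (intro p2_cong_sum) auto
  have "(\<Sum>k\<le>n. (3 * of_nat k + 1) * cubic_term k) \<doteq> (\<Sum>k\<le>n. (3 * of_nat k + 1) * (of_nat p * wz_term n k))"
    using ct p2_cong_sym by (intro p2_cong_sum p2_cong_mult_left) auto
  also have "(\<Sum>k\<le>n. (3 * of_nat k + 1) * (of_nat p * wz_term n k)) = (-1) ^ n * of_nat p"
    unfolding sum_linear_wz_term[symmetric] sum_distrib_right by (simp add: mult_ac)
  finally have V: "(\<Sum>k\<le>n. (3 * of_nat k + 1) * cubic_term k) \<doteq> (-1) ^ n * of_nat p" .
  \<comment> \<open>The bound n + 2 < 2n + 1 = p is where \<open>n \<ge> 2\<close> is used; it makes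
    the boundary term a multiple of p^3.\<close>
  have "\<not> p dvd n + 1" "\<not> p dvd n + 2" using p assms(2) by (auto dest: dvd_imp_le)
  then have "p_unit (of_nat (n + 1) * of_nat (n + 2))" by (intro p_unit_mult p_unit_of_nat)
  then have "p_unit ((of_nat n + 1) * (of_nat n + 2))" by (simp add: add.commute)
  then have "of_nat p * (cubic_term n / ((of_nat n + 1) * (of_nat n + 2))) \<in> p_integral"
    using ct[of n] by (intro p_integral_mult p_integral_divide) auto
  moreover have "2 * of_nat n + 1 = (of_nat p :: rat)" by (simp add: p)
  ultimately have B: "(2 * of_nat n + 1) ^ 3 * (cubic_term n / ((of_nat n + 1) * (of_nat n + 2))) \<doteq> 0"
    by (intro p2_congI[of _ _ "of_nat p * (cubic_term n / ((of_nat n + 1) * (of_nat n + 2)))"])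
       (simp_all add: power2_eq_square power3_eq_cube)
  from p2_cong_add[OF p2_cong_diff[OF p2_cong_mult_left[OF T, of 16] p2_cong_mult_left[OF V, of 3]] B]
  show ?thesis unfolding sum_cubic_term_divide by simp
qed

section \<open>The closed form in terms of the Jacobsthal sum\<close>

text \<open>Here \<open>F\<close>, \<open>G\<close>, \<open>W\<close> are the values of \<open>f\<close> at \<open>p\<close>, \<open>-p\<close>, \<open>-p/2\<close>, and \<open>g\<close> is the derivative of \<open>f\<close> at \<open>0\<close>.\<close>

lemma p2_cong_unit_root:
  defines "P \<equiv> of_nat p :: rat"
  assumes int: "C \<in> p_integral" "g \<in> p_integral" "X \<in> p_integral" "D \<in> p_integral" "J \<in> p_integral" "1 / 2 \<in> p_integral"
    and units: "p_unit C" "p_unit (3 * P - 1)" "p_unit 2"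
    and F: "F \<doteq> C + P * g" and G: "G \<doteq> C - P * g" and W: "W \<doteq> C - P * (1 / 2) * g" and E: "E \<doteq> 1"
    and XD: "X * D = 16 ^ m * C" and DC: "D * C * G = F * E" and W2: "W ^ 2 * 16 ^ m = C ^ 2"
    and B: "2 * B * (3 * P - 1) = F * (5 * P - 1)" and Q: "Q * (3 * P - 1) = 2 * P * D"
    and J: "2 * J \<doteq> (P - 1) * (3 * C - 2 * B - Q)"
  shows "X \<doteq> J ^ 2 - 2 * P"
proof -
  have P: "P \<in> p_integral" by (simp add: P_def)
  have fint: "F \<in> p_integral" "G \<in> p_integral" "W \<in> p_integral" "E \<in> p_integral"
    by (rule p2_cong_integral[OF F] p2_cong_integral[OF G] p2_cong_integral[OF W] p2_cong_integral[OF E];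
        intro p_integral_add p_integral_diff p_integral_mult int P numeral_p_integral)+
  \<comment> \<open>The unknown \<open>D\<close> is eliminated between the relations for
    \<open>X * D\<close> and \<open>D * C * G\<close>.\<close>
  have "X * (F * E * W ^ 2) = X * D * (W ^ 2 * C * G)" unfolding DC[symmetric] by (simp add: mult_ac)
  also have "\<dots> = (W ^ 2 * 16 ^ m) * C ^ 2 * G" unfolding XD by (simp add: power2_eq_square mult_ac)
  also have "\<dots> = C ^ 4 * G" unfolding W2 by (simp add: power_add[symmetric])
  finally have X: "X * (F * E * W ^ 2) = C ^ 4 * G" .
  \<comment> \<open>The linear terms cancel because 1 - 2 (1/2) = 0, leaving only
    \<open>C ^ 3\<close>.\<close>
  have "F * E * W ^ 2 \<doteq> (C + P * g) * 1 * (C - P * (1 / 2) * g) ^ 2"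
    unfolding power2_eq_square
    by (intro p2_cong_mult F E W fint p_integral_add p_integral_diff p_integral_mult int P numeral_p_integral)
  also have "\<dots> \<doteq> C ^ 3"
    using p_integral_mult[OF int(6) p_integral_mult[OF int(6)]] int P
    by (intro p2_congI[of _ _ "(1 / 2) * (1 / 2) * (- 3 * C * g ^ 2 + P * g ^ 3)"])
       (simp_all add: P_def[symmetric] power2_eq_square power3_eq_cube algebra_simps)
  finally have "X * (F * E * W ^ 2) \<doteq> X * C ^ 3" using int by (intro p2_cong_mult_left)
  then have "C ^ 3 * X \<doteq> C ^ 4 * G" using p2_cong_sym X by (simp add: mult.commute)
  also have "\<dots> \<doteq> C ^ 4 * (C - P * g)" using G int by (intro p2_cong_mult_left) simp_all
  also have "\<dots> = C ^ 3 * (C ^ 2 - C * P * g)" by Groebner_Basis.algebra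
  finally have X': "X \<doteq> C ^ 2 - C * P * g" using units by (meson p2_cong_cancel p_unit_power)
  \<comment> \<open>After multiplication by \<open>P\<close> the linear parts of \<open>F\<close>
    and \<open>G\<close> disappear modulo p^2, so \<open>D * C\<close> is only needed modulo
    p.\<close>
  have step: "P * (C + P * y) \<doteq> P * C" if "y \<in> p_integral" for y
    using that by (intro p2_congI[of _ _ y]) (simp_all add: P_def power2_eq_square algebra_simps)
  have "C * (P * D * C) = D * C * (P * C)" by (simp add: mult_ac)
  also have "D * C * (P * C) \<doteq> D * C * (P * (C + P * (- g)))"
    using int by (intro p2_cong_mult_left[OF p2_cong_sym[OF step]]) simp_all
  also have "\<dots> \<doteq> D * C * (P * G)"
    using G int P p2_cong_sym by (intro p2_cong_mult_left) simp_all
  also have "D * C * (P * G) = P * (F * E)" unfolding DC[symmetric] by (simp add: mult_ac)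
  also have "\<dots> \<doteq> P * ((C + P * g) * 1)"
    using F E fint int P by (intro p2_cong_mult_left p2_cong_mult) simp_all
  also have "\<dots> \<doteq> C * P" using step[of g] int by (simp add: mult.commute)
  finally have PDC: "P * D * C \<doteq> P" using units p2_cong_cancel by blast
  \<comment> \<open>Multiplying by the units \<open>3 * P - 1\<close> and \<open>C\<close> clears
    the denominators in \<open>B\<close>, \<open>Q\<close> and \<open>D\<close>.\<close>
  have "(3 * P - 1) * (2 * J * C) = C * (3 * P - 1) * (2 * J)" by (simp add: mult_ac)
  also have "\<dots> \<doteq> C * (3 * P - 1) * ((P - 1) * (3 * C - 2 * B - Q))"
    using J int P by (intro p2_cong_mult_left) simp_all
  also have "C * (3 * P - 1) * ((P - 1) * (3 * C - 2 * B - Q))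
     = (P - 1) * (3 * C ^ 2 * (3 * P - 1) - C * (2 * B * (3 * P - 1)) - C * (Q * (3 * P - 1)))"
    by (simp add: algebra_simps power2_eq_square)
  also have "\<dots> = (P - 1) * (3 * C ^ 2 * (3 * P - 1) - C * (5 * P - 1) * F - 2 * (P * D * C))"
    unfolding B Q by (simp add: mult_ac)
  also have "\<dots> \<doteq> (P - 1) * (3 * C ^ 2 * (3 * P - 1) - C * (5 * P - 1) * (C + P * g) - 2 * P)"
    using F PDC int P by (intro p2_cong_mult_left p2_cong_diff p2_cong_refl) simp_all
  also have "\<dots> \<doteq> (3 * P - 1) * (- 2 * C ^ 2 + P * g * C - 2 * P)"
    using int P
    by (intro p2_congI[of _ _ "4 * C ^ 2 + 3 * g * C + 4 - 5 * P * g * C"])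
       (simp_all add: P_def[symmetric] power2_eq_square power3_eq_cube algebra_simps)
  finally have JC: "2 * J * C \<doteq> - 2 * C ^ 2 + P * g * C - 2 * P" using units p2_cong_cancel by blast
  \<comment> \<open>Squaring the formula for \<open>2 * J * C\<close> gives the same combination of
    \<open>C\<close> and \<open>g\<close> as for \<open>X\<close>, shifted by
    \<open>2 * P\<close>.\<close>
  have "(2 * C) ^ 2 * J ^ 2 = (2 * J * C) * (2 * J * C)" by (simp add: power2_eq_square mult_ac)
  also have "\<dots> \<doteq> (- 2 * C ^ 2 + P * g * C - 2 * P) * (- 2 * C ^ 2 + P * g * C - 2 * P)"
    using JC int P by (intro p2_cong_mult) simp_all
  also have "\<dots> \<doteq> (2 * C) ^ 2 * (C ^ 2 - C * P * g + 2 * P)"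
    using int P
    by (intro p2_congI[of _ _ "(g * C - 2) ^ 2"])
       (simp_all add: P_def[symmetric] power2_eq_square algebra_simps)
  finally have "J ^ 2 \<doteq> C ^ 2 - C * P * g + 2 * P"
    using units by (meson p2_cong_cancel p_unit_power p_unit_mult)
  then have "J ^ 2 - 2 * P \<doteq> C ^ 2 - C * P * g + 2 * P - 2 * P" by (intro p2_cong_diff) simp_all
  then have "J ^ 2 - 2 * P \<doteq> C ^ 2 - C * P * g" by simp
  from p2_cong_trans[OF X' p2_cong_sym[OF this]] show ?thesis .
qed

lemma p2_cong_prod_1: "(\<And>i. i \<in> I \<Longrightarrow> h i \<doteq> 1) \<Longrightarrow> prod h I \<doteq> 1"
proof (induction I rule: infinite_finite_induct)
  case (insert i I)
  then have "h i * prod h I \<doteq> 1 * 1" using p2_cong_integral[of "prod h I" 1] by (intro p2_cong_mult) simp_all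
  then show ?case using insert.hyps by simp
qed simp_all

text \<open>Supplies the hypotheses of \<open>p2_cong_unit_root\<close>: via factorials, the
  binomial coefficients are related to the values of \<open>f\<close> at 1, -1 and -1/2.\<close>

lemma sum_wz_term_cong_jacobsthal:
  assumes p: "p = 4 * m + 1"
  shows "of_nat p * (\<Sum>k\<le>2 * m. wz_term (2 * m) k) \<doteq> of_int ((jacobsthal 1)\<^sup>2) - 2 * of_nat p"
proof -
  define P :: rat where "P = of_nat p"
  define C where "C = (of_nat ((2 * m) choose m) :: rat)"
  define X where "X = P * (\<Sum>k\<le>2 * m. wz_term (2 * m) k)"
  define B where "B = (of_nat ((6 * m) choose m) :: rat)"
  define Q where "Q = (of_nat ((6 * m) choose (3 * m)) :: rat)"
  \<comment> \<open>The argument is rescaled: \<open>y\<close> stands for the point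
    \<open>P * y\<close>.\<close>
  define f where "f y = (\<Prod>i\<in>{m + 1..2 * m}. P * y + of_nat i) / fact m" for y
  \<comment> \<open>The correction factor in \<open>D * C * f (-1) = f 1 * E\<close>; every factor
    is 1 modulo p^2 since \<open>i\<close> is less than p.\<close>
  define E where "E = (\<Prod>i\<in>{1..m}. 1 - P ^ 2 / of_nat i ^ 2)"
  have m: "m > 0" using p gt_2 by (cases m) auto
  have PM: "P = 4 * of_nat m + 1" by (simp add: P_def p)
  have Pnz: "P \<noteq> 0" using prime by (auto simp: P_def)
  have fact_unit: "p_unit (fact k)" if "k < p" for k
    using p_unit_of_nat[of "fact k"] prime that by (simp add: prime_dvd_fact_iff)
  have pf: "(\<Prod>i\<in>{a + 1..b}. of_nat i) = (fact b / fact a :: rat)" if "a \<le> b" for a b :: nat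
    using that by (induction rule: dec_induct) (simp_all add: divide_simps)
  have C: "C = fact (2 * m) / (fact m * fact m)"
    unfolding C_def by (subst binomial_fact) simp_all

  obtain e where e: "e \<in> p_integral"
    "\<And>y. y \<in> p_integral \<Longrightarrow> (\<Prod>i\<in>{m + 1..2 * m}. P * y + of_nat i) \<doteq> of_nat (\<Prod>{m + 1..2 * m}) + P * y * e"
    using prod_shift_linear[of "{m + 1..2 * m}"] unfolding P_def by auto
  define g where "g = e / fact m"
  have fm: "p_unit (fact m)" using fact_unit p by simp
  have g: "g \<in> p_integral" unfolding g_def using e fm by (intro p_integral_divide)
  have f: "f y \<doteq> C + P * y * g" if "y \<in> p_integral" for y
  proof -
    have "(1 / fact m) * (\<Prod>i\<in>{m + 1..2 * m}. P * y + of_nat i) \<doteq> (1 / fact m) * (of_nat (\<Prod>{m + 1..2 * m}) + P * y * e)"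
      using e that fm by (intro p2_cong_mult_left) (auto simp: p_unit_def)
    also have "(1 / fact m) * (of_nat (\<Prod>{m + 1..2 * m}) + P * y * e) = C + P * y * g"
      using pf[of m "2 * m"] by (simp add: C g_def add_divide_distrib)
    finally show ?thesis by (simp add: f_def)
  qed

  have f1: "f 1 = fact (6 * m + 1) / fact (5 * m + 1) / fact m"
  proof -
    have "(\<Prod>i\<in>{m + 1..2 * m}. P * 1 + of_nat i) = (\<Prod>i\<in>{m + 1..2 * m}. of_nat (i + (4 * m + 1)))"
      by (intro prod.cong) (simp_all add: PM)
    also have "\<dots> = (\<Prod>i\<in>{m + 1 + (4 * m + 1)..2 * m + (4 * m + 1)}. of_nat i)"
      by (rule prod.shift_bounds_cl_nat_ivl[symmetric])
    also have "{m + 1 + (4 * m + 1)..2 * m + (4 * m + 1)} = {(5 * m + 1) + 1..6 * m + 1}" by auto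
    finally show ?thesis using pf[of "5 * m + 1" "6 * m + 1"] by (simp add: f_def del: fact_Suc)
  qed
  have f2: "f (-1) = (-1) ^ m * fact (3 * m) / fact (2 * m) / fact m"
  proof -
    have "(\<Prod>i\<in>{m + 1..2 * m}. P * (-1) + of_nat i) = (\<Prod>i\<in>{m + 1..2 * m}. - 1 * of_nat (4 * m + 1 - i))"
      by (intro prod.cong) (simp_all add: PM of_nat_diff)
    also have "\<dots> = (-1) ^ m * (\<Prod>i\<in>{m + 1..2 * m}. of_nat (4 * m + 1 - i))"
      by (subst prod.distrib) simp
    also have "(\<Prod>i\<in>{m + 1..2 * m}. of_nat (4 * m + 1 - i)) = (\<Prod>i\<in>{2 * m + 1..3 * m}. of_nat i :: rat)"
      by (rule prod.reindex_bij_witness[of _ "\<lambda>i. 4 * m + 1 - i" "\<lambda>i. 4 * m + 1 - i"]) auto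
    finally show ?thesis using pf[of "2 * m" "3 * m"] by (simp add: f_def)
  qed
  have W: "f (- (1 / 2)) = (-1) ^ m * C / 4 ^ m"
  proof -
    have "(\<Prod>i\<in>{m + 1..2 * m}. P * (- (1 / 2)) + of_nat i) = (\<Prod>j\<in>{..<m}. - (1 / 2) * (2 * of_nat j + 1))"
      by (rule prod.reindex_bij_witness[of _ "\<lambda>j. 2 * m - j" "\<lambda>i. 2 * m - i"])
         (auto simp: PM of_nat_diff field_simps)
    also have "\<dots> = (- (1 / 2)) ^ m * (\<Prod>j<m. 2 * of_nat j + 1)"
      by (subst prod.distrib) simp
    also have "\<dots> = (-1) ^ m / 4 ^ m * (2 ^ m * (\<Prod>j<m. 2 * of_nat j + 1))"
    proof -
      have "(- (1 / 2) :: rat) ^ m = (-1) ^ m / 4 ^ m * 2 ^ m"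
        unfolding power_divide[symmetric] power_mult_distrib[symmetric] by simp
      then show ?thesis by simp
    qed
    also have "2 ^ m * (\<Prod>j<m. 2 * of_nat j + 1) = C * fact m"
      unfolding C_def by (rule binomial_times_fact_odd[symmetric])
    finally show ?thesis by (simp add: f_def)
  qed
  have E: "E = (-1) ^ m * fact (5 * m + 1) / (P * fact (3 * m) * fact m ^ 2)"
  proof -
    have "E = (\<Prod>i\<in>{1..m}. (- 1) * (P + of_nat i) * (P - of_nat i) / (of_nat i * of_nat i))"
      unfolding E_def by (intro prod.cong) (auto simp: field_simps power2_eq_square)
    also have "\<dots> = (-1) ^ m * (\<Prod>i\<in>{1..m}. P + of_nat i) * (\<Prod>i\<in>{1..m}. P - of_nat i)
       / ((\<Prod>i\<in>{1..m}. of_nat i) * (\<Prod>i\<in>{1..m}. of_nat i))"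
      by (simp only: prod.distrib prod_dividef prod_constant card_atLeastAtMost) simp
    also have "(\<Prod>i\<in>{1..m}. of_nat i) = (fact m :: rat)" using pf[of 0 m] by simp
    also have "(\<Prod>i\<in>{1..m}. P + of_nat i) = fact (5 * m + 1) / fact (4 * m + 1)"
    proof -
      have "(\<Prod>i\<in>{1..m}. P + of_nat i) = (\<Prod>i\<in>{1..m}. of_nat (i + (4 * m + 1)))"
        by (intro prod.cong) (simp_all add: PM)
      also have "\<dots> = (\<Prod>i\<in>{1 + (4 * m + 1)..m + (4 * m + 1)}. of_nat i)"
        by (rule prod.shift_bounds_cl_nat_ivl[symmetric])
      also have "{1 + (4 * m + 1)..m + (4 * m + 1)} = {(4 * m + 1) + 1..5 * m + 1}" by auto
      finally show ?thesis using pf[of "4 * m + 1" "5 * m + 1"] by (simp del: fact_Suc)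
    qed
    also have "(\<Prod>i\<in>{1..m}. P - of_nat i) = fact (4 * m) / fact (3 * m)"
    proof -
      have "(\<Prod>i\<in>{1..m}. P - of_nat i) = (\<Prod>i\<in>{3 * m + 1..4 * m}. of_nat i)"
        by (rule prod.reindex_bij_witness[of _ "\<lambda>i. 4 * m + 1 - i" "\<lambda>i. 4 * m + 1 - i"])
           (auto simp: PM of_nat_diff)
      then show ?thesis using pf[of "3 * m" "4 * m"] by simp
    qed
    also have "fact (4 * m + 1) = P * (fact (4 * m) :: rat)" by (simp add: PM add.commute)
    finally show ?thesis by (simp add: power2_eq_square del: fact_Suc)
  qed
  have E1: "E \<doteq> 1"
    unfolding E_def
  proof (rule p2_cong_prod_1)
    fix i assume i: "i \<in> {1..m}"
    then have "\<not> p dvd i" using p by (auto dest: dvd_imp_le)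
    then have "p_unit (of_nat i ^ 2)" by (intro p_unit_power p_unit_of_nat)
    then have "- (1 / of_nat i ^ 2) \<in> p_integral" by (intro p_integral_uminus p_integral_divide) simp_all
    then show "1 - P ^ 2 / of_nat i ^ 2 \<doteq> 1"
      by (rule p2_congI[rotated]) (simp add: P_def)
  qed

  \<comment> \<open>Since 3m < p and p is at most 6m, the central coefficient is divisible by p;
    this makes \<open>D\<close>, the quotient of (6m + 1) \<open>Q\<close> by p, integral.\<close>
  have "p dvd ((6 * m) choose (3 * m)) * (fact (3 * m) * fact (3 * m))"
  proof -
    have "fact (3 * m) * fact (6 * m - 3 * m) * ((6 * m) choose (3 * m)) = (fact (6 * m) :: nat)"
      by (rule binomial_fact_lemma) simp
    moreover have "p dvd fact (6 * m)" using prime p m by (simp add: prime_dvd_fact_iff)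
    ultimately show ?thesis by (simp add: mult_ac)
  qed
  moreover have "\<not> p dvd fact (3 * m)" using prime p by (simp add: prime_dvd_fact_iff)
  ultimately obtain q where q: "(6 * m) choose (3 * m) = p * q"
    using prime by (auto simp: prime_dvd_mult_iff)
  define D where "D = of_nat (6 * m + 1) * (of_nat q :: rat)"
  have QD: "of_nat (6 * m + 1) * Q = P * D" by (simp add: Q_def q D_def P_def)
  have Qf: "Q = fact (6 * m) / (fact (3 * m) * fact (3 * m))"
    unfolding Q_def by (subst binomial_fact) simp_all
  have Df: "P * D = fact (6 * m + 1) / (fact (3 * m) * fact (3 * m))"
    unfolding QD[symmetric] Qf by simp

  have "X \<doteq> of_int (jacobsthal 1) ^ 2 - 2 * P"
  proof (rule p2_cong_unit_root[where C = C and g = g and D = D and F = "f 1" and G = "f (-1)" and W = "f (- (1 / 2))"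
        and E = E and m = m and B = B and Q = Q, folded P_def])
    have "\<not> p dvd 2" using gt_2 by (auto dest: dvd_imp_le)
    then have "p_unit 2" using p_unit_of_nat[of 2] by simp
    then show half: "p_unit 2" "1 / 2 \<in> p_integral" by (simp_all add: p_unit_def)
    show "f 1 \<doteq> C + P * g" "f (-1) \<doteq> C - P * g" "f (- (1 / 2)) \<doteq> C - P * (1 / 2) * g"
      using f[of 1] f[of "-1"] f[of "- (1 / 2)"] half by simp_all
    show "C \<in> p_integral" "g \<in> p_integral" "D \<in> p_integral" "of_int (jacobsthal 1) \<in> p_integral"
      using g by (simp_all add: C_def D_def)
    have "\<not> p dvd (2 * m) choose m"
    proof
      assume "p dvd (2 * m) choose m"
      then have "p dvd fact m * fact (2 * m - m) * ((2 * m) choose m)" by simp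
      also have "fact m * fact (2 * m - m) * ((2 * m) choose m) = fact (2 * m)"
        by (rule binomial_fact_lemma) simp
      finally show False using prime p by (simp add: prime_dvd_fact_iff)
    qed
    then show "p_unit C" unfolding C_def by (rule p_unit_of_nat)
    have "\<not> int p dvd 3 * int p - 1"
      using prime_int not_prime_unit by (metis dvd_diff_right_iff dvd_triv_right)
    from p_unit_of_int[OF this] show "p_unit (3 * P - 1)" by (simp add: P_def)
    have "X = (\<Sum>k\<le>2 * m. P * wz_term (2 * m) k)" by (simp add: X_def sum_distrib_left)
    also have "\<dots> \<in> p_integral"
      using cubic_term_cong_wz_term[of "2 * m"] p p2_cong_integral unfolding P_def
      by (intro p_integral_sum) auto
    finally show "X \<in> p_integral" .
    show "E \<doteq> 1" by (rule E1)
    show "X * D = 16 ^ m * C"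
    proof -
      have "X * D = (P * D) * (\<Sum>k\<le>2 * m. wz_term (2 * m) k)" by (simp add: X_def mult_ac)
      then show ?thesis using sum_wz_term_even[of m] unfolding QD[symmetric] C_def Q_def by simp
    qed
    show "D * C * f (-1) = f 1 * E"
    proof -
      have "P * (D * C * f (-1)) = P * (f 1 * E)"
        using Df Pnz unfolding mult.assoc[symmetric] unfolding C f1 f2 E by (simp add: power2_eq_square del: fact_Suc)
      then show ?thesis using Pnz by simp
    qed
    have "(16 :: rat) ^ m = (4 ^ m) ^ 2" by (simp add: power_mult[symmetric] mult.commute[of m] power_mult)
    moreover have "((-1) ^ m) ^ 2 = (1 :: rat)" by (simp add: power_mult[symmetric])
    ultimately show "(f (- (1 / 2))) ^ 2 * 16 ^ m = C ^ 2"
      unfolding W by (simp only: power_mult_distrib power_divide) simp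
    show "2 * B * (3 * P - 1) = f 1 * (5 * P - 1)"
    proof -
      have "B = fact (6 * m) / (fact m * fact (5 * m))" unfolding B_def by (subst binomial_fact) simp_all
      moreover have "fact (6 * m + 1) = (6 * of_nat m + 1) * (fact (6 * m) :: rat)"
        "fact (5 * m + 1) = (5 * of_nat m + 1) * (fact (5 * m) :: rat)" by (simp_all add: add.commute)
      moreover have "(5 * of_nat m + 1 :: rat) \<noteq> 0" using of_nat_0_le_iff[of m, where ?'a = rat] by linarith
      moreover have "3 * P - 1 = 2 * (6 * of_nat m + 1)" "5 * P - 1 = 4 * (5 * of_nat m + 1)" by (simp_all add: PM)
      ultimately show ?thesis unfolding f1 by (simp add: mult_ac del: fact_Suc distrib_left_numeral)
    qed
    have "3 * P - 1 = 2 * of_nat (6 * m + 1)" by (simp add: PM)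
    then have "Q * (3 * P - 1) = 2 * (of_nat (6 * m + 1) * Q)" by (simp only: mult_ac)
    then show "Q * (3 * P - 1) = 2 * P * D" unfolding QD by (simp only: mult_ac)
    have "of_int (2 * jacobsthal 1) \<doteq> of_int ((int p - 1) * (3 * int ((2 * m) choose m)
      - 2 * int ((6 * m) choose m) - int ((6 * m) choose (3 * m))))"
      by (rule p2_cong_of_int[OF jacobsthal_1_binomial[OF p]])
    then show "2 * of_int (jacobsthal 1) \<doteq> (P - 1) * (3 * C - 2 * B - Q)"
      by (simp add: P_def C_def B_def Q_def)
  qed
  then show ?thesis by (simp add: X_def P_def)
qed

end

section \<open>Conclusion in the two residue classes modulo 4\<close>

theorem theorem6p6:
  fixes p :: nat
  assumes "prime p" and "p > 3"
  defines "S \<equiv> (\<Sum>k = 0..(p - 1) div 2.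
             (of_nat ((2 * k) choose k) ^ 3) / ((-8) ^ k * of_nat (k + 2)) :: rat)"
  shows "(p mod 4 = 1 \<longrightarrow>
            (\<forall>x y :: int. int p = x\<^sup>2 + 4 * y\<^sup>2 \<longrightarrow>
               rat_cong_pow p 2 S (64 / 27 * of_int (x\<^sup>2) - 35 / 27 * of_nat p)))
       \<and> (p mod 4 = 3 \<longrightarrow> rat_cong_pow p 2 S (of_nat p / 9))"
proof -
  interpret odd_prime p using assms by unfold_locales simp_all
  define n where "n = (p - 1) div 2"
  have "odd p" using assms by (simp add: prime_odd_nat)
  then have p: "p = 2 * n + 1" by (auto simp: n_def elim!: oddE)
  then have "n \<ge> 2" using assms by simp
  have S: "S = (\<Sum>k\<le>n. cubic_term k / (of_nat k + 2))"
    unfolding S_def n_def[symmetric] atLeast0AtMost cubic_term_def by (simp add: add.commute)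
  note main = sum_cubic_term_divide_cong[OF p \<open>n \<ge> 2\<close>, folded S]
  have "\<not> p dvd 27"
  proof
    assume "p dvd 27"
    then have "p dvd 3 ^ 3" by simp
    then have "p dvd 3" using assms(1) prime_dvd_power by blast
    then show False using assms by (auto dest: dvd_imp_le)
  qed
  then have u: "p_unit 27" using p_unit_of_nat[of 27] by simp
  show ?thesis
  proof (intro conjI impI allI)
    fix x y :: int
    assume p4: "p mod 4 = 1" and xy: "int p = x\<^sup>2 + 4 * y\<^sup>2"
    define m where "m = n div 2"
    have m: "n = 2 * m" "p = 4 * m + 1" using p p4 unfolding m_def by presburger+
    \<comment> \<open>With J^2 = 4x^2 and even \<open>n\<close> the right-hand side of
      \<open>main\<close> becomes 16 (4x^2 - 2p) - 3p = 64x^2 - 35p.\<close>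
    have "of_nat p * (\<Sum>k\<le>n. wz_term n k) \<doteq> of_int (4 * x\<^sup>2) - 2 * of_nat p"
      using sum_wz_term_cong_jacobsthal[OF m(2)] jacobsthal_1_sq[OF p4 xy] m(1) by simp
    then have "16 * (of_nat p * (\<Sum>k\<le>n. wz_term n k)) - 3 * ((-1) ^ n * of_nat p)
       \<doteq> 16 * (of_int (4 * x\<^sup>2) - 2 * of_nat p) - 3 * ((-1) ^ n * of_nat p)"
      by (intro p2_cong_diff p2_cong_mult_left) simp_all
    from p2_cong_trans[OF main this]
    have "27 * S \<doteq> 27 * (64 / 27 * of_int (x\<^sup>2) - 35 / 27 * of_nat p)"
      by (simp add: m(1) algebra_simps)
    then show "S \<doteq> 64 / 27 * of_int (x\<^sup>2) - 35 / 27 * of_nat p"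
      using u p2_cong_cancel by blast
  next
    assume p4: "p mod 4 = 3"
    define m where "m = n div 2"
    have m: "n = 2 * m + 1" using p p4 unfolding m_def by presburger
    \<comment> \<open>For odd \<open>n\<close> the unweighted sum vanishes and the sign (-1)^n turns
      the remaining term into 3p.\<close>
    have "27 * S \<doteq> 27 * (of_nat p / 9)"
      using main sum_wz_term_odd[of m] unfolding m by simp
    then show "S \<doteq> of_nat p / 9" using u p2_cong_cancel by blast
  qed
qed

end
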